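(* Let $K$ be a field of characteristic zero, $A$ a commutative associative unital $K$-algebra, $(G,\rho)$ a Lie--Rinehart algebra over $A$, and $\mathcal G=\bigwedge_AG$ with its Schouten--Nijenhuis bracket $[\cdot,\cdot]_{SN}$. For homogeneous $P\in\mathcal G^p$ put $\operatorname{ad}_{SN}(P):\mathcal G\to\mathcal G$, $\operatorname{ad}_{SN}(P)(R)=[P,R]_{SN}$. Then for homogeneous $P\in\mathcal G^p$ and $Q\in\mathcal G^q$, \[ [\operatorname{ad}_{SN}(P),\operatorname{ad}_{SN}(Q)]=\operatorname{ad}_{SN}([P,Q]_{SN}), \] where the bracket on the left is the graded commutator.
   Context: A Lie--Rinehart algebra over $A$ is an $A$-module $G$ endowed with a $K$-Lie bracket $[\cdot,\cdot]$ and an $A$-linear map $\rho:G\to\operatorname{Der}_K(A)$ (the anchor) that is a morphism of $K$-Lie algebras, such that $[x,ay]=a[x,y]+\rho(x)(a)y$ for all $a\in A$, $x,y\in G$. $\mathcal G=\bigwedge_AG=\bigoplus_{p\ge0}\mathcal G^p$ is the exterior algebra over $A$, $\mathcal G^p=\bigwedge_A^pG$, with $\mathcal G^0=A$, $\mathcal G^1=G$ and $\mathcal G^p=0$ for $p<0$. The Schouten--Nijenhuis bracket $[\cdot,\cdot]_{SN}$ is the (well-defined) $K$-bilinear map $\mathcal G\times\mathcal G\to\mathcal G$ given on decomposable elements as follows. For $X=x_1\wedge\cdots\wedge x_p$ and $Y=y_1\wedge\cdots\wedge y_q$ with $x_i,y_j\in G$, let $\widehat X_i$ be $X$ with the factor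 $x_i$ omitted ($\widehat X_1=1$ if $p=1$), and similarly $\widehat Y_j$. For $p,q\ge1$, \[ [X,Y]_{SN}=\sum_{i=1}^p\sum_{j=1}^q(-1)^{i+j}[x_i,y_j]\wedge\widehat X_i\wedge\widehat Y_j . \] For $a\in A$ and $p\ge1$, \[ [X,a]_{SN}=\sum_{i=1}^p(-1)^{p-i}\rho(x_i)(a)\,\widehat X_i,\qquad [a,X]_{SN}=\sum_{i=1}^p(-1)^{i}\rho(x_i)(a)\,\widehat X_i . \] For $a,b\in A$, $[a,b]_{SN}=0$. For $P\in\mathcal G^p$ the operator $\operatorname{ad}_{SN}(P)$ has degree $p-1$. The graded commutator of operators $D_1,D_2$ of degrees $d_1,d_2$ is $[D_1,D_2]=D_1\circ D_2-(-1)^{d_1d_2}D_2\circ D_1$; so here $d_1=p-1$, $d_2=q-1$. *)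

theory Defs
  imports Complex_Main "HOL-Library.Poly_Mapping"
begin

text \<open>
  The sort \<open>{comm_ring, comm_monoid_mult}\<close> is that of commutative unital rings in which
  \<open>0 = 1\<close> is allowed. The class \<open>comm_ring_1\<close>, and with it the library locale \<open>module\<close>, would
  exclude the zero algebra; for this reason the module axioms are written out in \<open>lie_rinehart\<close>.
\<close>

locale comm_algebra = vector_space kscale
  for kscale :: "'k::field_char_0 \<Rightarrow> 'a::{comm_ring,comm_monoid_mult} \<Rightarrow> 'a" +
  assumes kscale_mult_left: "kscale c (a * b) = kscale c a * b"

definition k_derivation ::
    "('k::field \<Rightarrow> 'a::{comm_ring,comm_monoid_mult} \<Rightarrow> 'a) \<Rightarrow> ('a \<Rightarrow> 'a) \<Rightarrow> bool" where
  "k_derivation kscale D \<longleftrightarrow>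
     Vector_Spaces.linear kscale kscale D \<and> (\<forall>a b. D (a * b) = D a * b + a * D b)"

locale lie_algebra = vector_space scale
  for scale :: "'k::field \<Rightarrow> 'g::ab_group_add \<Rightarrow> 'g" +
  fixes br :: "'g \<Rightarrow> 'g \<Rightarrow> 'g"
  assumes br_linear_left: "Vector_Spaces.linear scale scale (\<lambda>x. br x y)"
    and br_linear_right: "Vector_Spaces.linear scale scale (br x)"
    and br_self: "br x x = 0"
    and br_jacobi: "br x (br y z) + br y (br z x) + br z (br x y) = 0"

text \<open>The \<open>K\<close>-vector space structure of \<open>G\<close> is the one induced along \<open>c \<mapsto> c \<cdot> 1\<^sub>A\<close>.\<close>

locale lie_rinehart =
  alg: comm_algebra kscale + lie: lie_algebra "\<lambda>c. gscale (kscale c 1)" br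
  for kscale :: "'k::field_char_0 \<Rightarrow> 'a::{comm_ring,comm_monoid_mult} \<Rightarrow> 'a"
    and gscale :: "'a \<Rightarrow> 'g::ab_group_add \<Rightarrow> 'g"
    and br :: "'g \<Rightarrow> 'g \<Rightarrow> 'g" +
  fixes anchor :: "'g \<Rightarrow> 'a \<Rightarrow> 'a"
  assumes gscale_add_right: "gscale a (x + y) = gscale a x + gscale a y"
    and gscale_add_left: "gscale (a + b) x = gscale a x + gscale b x"
    and gscale_gscale: "gscale a (gscale b x) = gscale (a * b) x"
    and gscale_one: "gscale 1 x = x"
    and anchor_derivation: "k_derivation kscale (anchor x)"
    and anchor_add: "anchor (x + y) a = anchor x a + anchor y a"
    and anchor_gscale: "anchor (gscale b x) a = b * anchor x a"
    and anchor_br: "anchor (br x y) a = anchor x (anchor y a) - anchor y (anchor x a)"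
    and br_gscale: "br x (gscale a y) = gscale a (br x y) + gscale (anchor x a) y"

text \<open>
  The exterior algebra \<open>\<And>\<^sub>A G\<close> is the quotient of the free \<open>A\<close>-module on words over \<open>G\<close>
  (the free associative \<open>A\<close>-algebra on the set \<open>G\<close>, with concatenation as product) by the
  two-sided ideal generated by the relations making \<open>x \<mapsto> [x]\<close> \<open>A\<close>-linear together with
  \<open>[x][x] = 0\<close>. Since the coefficient \<open>a\<close> and the words \<open>u\<close>, \<open>v\<close> below are arbitrary, the
  additive subgroup generated by these elements is that ideal. The word \<open>[x\<^sub>1, \<dots>, x\<^sub>p]\<close> with
  coefficient \<open>a\<close> represents \<open>a x\<^sub>1 \<and> \<dots> \<and> x\<^sub>p\<close>.
\<close>

inductive_set ext_ideal ::
    "('a::{comm_ring,comm_monoid_mult} \<Rightarrow> 'g::ab_group_add \<Rightarrow> 'g) \<Rightarrow> ('g list \<Rightarrow>\<^sub>0 'a) set"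
  for gscale :: "'a \<Rightarrow> 'g \<Rightarrow> 'g" where
  zero: "0 \<in> ext_ideal gscale"
| diff: "f \<in> ext_ideal gscale \<Longrightarrow> g \<in> ext_ideal gscale \<Longrightarrow> f - g \<in> ext_ideal gscale"
| additive: "Poly_Mapping.single (u @ [x + y] @ v) a - Poly_Mapping.single (u @ [x] @ v) a
     - Poly_Mapping.single (u @ [y] @ v) a \<in> ext_ideal gscale"
| homogeneous: "Poly_Mapping.single (u @ [gscale b x] @ v) a
     - Poly_Mapping.single (u @ [x] @ v) (a * b) \<in> ext_ideal gscale"
| alternating: "Poly_Mapping.single (u @ [x, x] @ v) a \<in> ext_ideal gscale"

definition ext_class ::
    "('a::{comm_ring,comm_monoid_mult} \<Rightarrow> 'g::ab_group_add \<Rightarrow> 'g) \<Rightarrow>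
     ('g list \<Rightarrow>\<^sub>0 'a) \<Rightarrow> ('g list \<Rightarrow>\<^sub>0 'a) set" where
  "ext_class gscale f = {g. g - f \<in> ext_ideal gscale}"

definition ext_algebra ::
    "('a::{comm_ring,comm_monoid_mult} \<Rightarrow> 'g::ab_group_add \<Rightarrow> 'g) \<Rightarrow>
     ('g list \<Rightarrow>\<^sub>0 'a) set set" where
  "ext_algebra gscale = range (ext_class gscale)"

text \<open>The degree is an integer; in negative degree only the zero class remains.\<close>

definition ext_power ::
    "('a::{comm_ring,comm_monoid_mult} \<Rightarrow> 'g::ab_group_add \<Rightarrow> 'g) \<Rightarrow> int \<Rightarrow>
     ('g list \<Rightarrow>\<^sub>0 'a) set set" where
  "ext_power gscale p =
     ext_class gscale ` {f. \<forall>w \<in> Poly_Mapping.keys f. int (length w) = p}"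

definition ext_add ::
    "('a::{comm_ring,comm_monoid_mult} \<Rightarrow> 'g::ab_group_add \<Rightarrow> 'g) \<Rightarrow>
     ('g list \<Rightarrow>\<^sub>0 'a) set \<Rightarrow> ('g list \<Rightarrow>\<^sub>0 'a) set \<Rightarrow> ('g list \<Rightarrow>\<^sub>0 'a) set" where
  "ext_add gscale X Y = (\<Union>f\<in>X. \<Union>g\<in>Y. ext_class gscale (f + g))"

definition ext_diff ::
    "('a::{comm_ring,comm_monoid_mult} \<Rightarrow> 'g::ab_group_add \<Rightarrow> 'g) \<Rightarrow>
     ('g list \<Rightarrow>\<^sub>0 'a) set \<Rightarrow> ('g list \<Rightarrow>\<^sub>0 'a) set \<Rightarrow> ('g list \<Rightarrow>\<^sub>0 'a) set" where
  "ext_diff gscale X Y = (\<Union>f\<in>X. \<Union>g\<in>Y. ext_class gscale (f - g))"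

definition ext_kscale ::
    "('k::field_char_0 \<Rightarrow> 'a::{comm_ring,comm_monoid_mult} \<Rightarrow> 'a) \<Rightarrow>
     ('a \<Rightarrow> 'g::ab_group_add \<Rightarrow> 'g) \<Rightarrow>
     'k \<Rightarrow> ('g list \<Rightarrow>\<^sub>0 'a) set \<Rightarrow> ('g list \<Rightarrow>\<^sub>0 'a) set" where
  "ext_kscale kscale gscale c X = (\<Union>f\<in>X. ext_class gscale (Poly_Mapping.map (kscale c) f))"

definition ext_scalar ::
    "('a::{comm_ring,comm_monoid_mult} \<Rightarrow> 'g::ab_group_add \<Rightarrow> 'g) \<Rightarrow> 'a \<Rightarrow>
     ('g list \<Rightarrow>\<^sub>0 'a) set" where
  "ext_scalar gscale a = ext_class gscale (Poly_Mapping.single [] a)"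

definition ext_wedge ::
    "('a::{comm_ring,comm_monoid_mult} \<Rightarrow> 'g::ab_group_add \<Rightarrow> 'g) \<Rightarrow> 'g list \<Rightarrow>
     ('g list \<Rightarrow>\<^sub>0 'a) set" where
  "ext_wedge gscale xs = ext_class gscale (Poly_Mapping.single xs 1)"

text \<open>Positions are counted from 1, so the \<open>i\<close>-th entry of \<open>xs\<close> is \<open>xs ! (i - 1)\<close>.\<close>

definition omit_nth :: "'g list \<Rightarrow> nat \<Rightarrow> 'g list" where
  "omit_nth xs i = take (i - 1) xs @ drop i xs"

text \<open>
  The sums on the right-hand sides of the last four clauses are taken in the free module before
  passing to classes; the signs enter through the \<open>K\<close>-scaling of the coefficients.
  The second clause fixes the value outside \<open>\<And>\<^sub>A G\<close>, so that the map is unique.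
\<close>

definition is_schouten_bracket ::
    "('k::field_char_0 \<Rightarrow> 'a::{comm_ring,comm_monoid_mult} \<Rightarrow> 'a) \<Rightarrow>
     ('a \<Rightarrow> 'g::ab_group_add \<Rightarrow> 'g) \<Rightarrow> ('g \<Rightarrow> 'g \<Rightarrow> 'g) \<Rightarrow> ('g \<Rightarrow> 'a \<Rightarrow> 'a) \<Rightarrow>
     (('g list \<Rightarrow>\<^sub>0 'a) set \<Rightarrow> ('g list \<Rightarrow>\<^sub>0 'a) set \<Rightarrow> ('g list \<Rightarrow>\<^sub>0 'a) set) \<Rightarrow> bool" where
  "is_schouten_bracket kscale gscale br anchor B \<longleftrightarrow>
     (\<forall>X \<in> ext_algebra gscale. \<forall>Y \<in> ext_algebra gscale. B X Y \<in> ext_algebra gscale) \<and>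
     (\<forall>X Y. X \<notin> ext_algebra gscale \<or> Y \<notin> ext_algebra gscale \<longrightarrow> B X Y = undefined) \<and>
     (\<forall>X \<in> ext_algebra gscale. \<forall>Y \<in> ext_algebra gscale. \<forall>Z \<in> ext_algebra gscale.
        B (ext_add gscale X Y) Z = ext_add gscale (B X Z) (B Y Z) \<and>
        B Z (ext_add gscale X Y) = ext_add gscale (B Z X) (B Z Y)) \<and>
     (\<forall>c. \<forall>X \<in> ext_algebra gscale. \<forall>Y \<in> ext_algebra gscale.
        B (ext_kscale kscale gscale c X) Y = ext_kscale kscale gscale c (B X Y) \<and>
        B X (ext_kscale kscale gscale c Y) = ext_kscale kscale gscale c (B X Y)) \<and>
     (\<forall>xs ys. xs \<noteq> [] \<longrightarrow> ys \<noteq> [] \<longrightarrow>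
        B (ext_wedge gscale xs) (ext_wedge gscale ys) =
        ext_class gscale (\<Sum>i = 1..length xs. \<Sum>j = 1..length ys.
          Poly_Mapping.single ([br (xs ! (i - 1)) (ys ! (j - 1))] @ omit_nth xs i @ omit_nth ys j)
            (kscale ((-1) ^ (i + j)) 1))) \<and>
     (\<forall>xs a. xs \<noteq> [] \<longrightarrow>
        B (ext_wedge gscale xs) (ext_scalar gscale a) =
        ext_class gscale (\<Sum>i = 1..length xs.
          Poly_Mapping.single (omit_nth xs i)
            (kscale ((-1) ^ (length xs - i)) (anchor (xs ! (i - 1)) a)))) \<and>
     (\<forall>xs a. xs \<noteq> [] \<longrightarrow>
        B (ext_scalar gscale a) (ext_wedge gscale xs) =
        ext_class gscale (\<Sum>i = 1..length xs.
          Poly_Mapping.single (omit_nth xs i)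
            (kscale ((-1) ^ i) (anchor (xs ! (i - 1)) a)))) \<and>
     (\<forall>a b. B (ext_scalar gscale a) (ext_scalar gscale b) = ext_class gscale 0)"

definition schouten_bracket ::
    "('k::field_char_0 \<Rightarrow> 'a::{comm_ring,comm_monoid_mult} \<Rightarrow> 'a) \<Rightarrow>
     ('a \<Rightarrow> 'g::ab_group_add \<Rightarrow> 'g) \<Rightarrow> ('g \<Rightarrow> 'g \<Rightarrow> 'g) \<Rightarrow> ('g \<Rightarrow> 'a \<Rightarrow> 'a) \<Rightarrow>
     ('g list \<Rightarrow>\<^sub>0 'a) set \<Rightarrow> ('g list \<Rightarrow>\<^sub>0 'a) set \<Rightarrow> ('g list \<Rightarrow>\<^sub>0 'a) set" where
  "schouten_bracket kscale gscale br anchor =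
     (THE B. is_schouten_bracket kscale gscale br anchor B)"

definition ad_SN ::
    "('k::field_char_0 \<Rightarrow> 'a::{comm_ring,comm_monoid_mult} \<Rightarrow> 'a) \<Rightarrow>
     ('a \<Rightarrow> 'g::ab_group_add \<Rightarrow> 'g) \<Rightarrow> ('g \<Rightarrow> 'g \<Rightarrow> 'g) \<Rightarrow> ('g \<Rightarrow> 'a \<Rightarrow> 'a) \<Rightarrow>
     ('g list \<Rightarrow>\<^sub>0 'a) set \<Rightarrow> ('g list \<Rightarrow>\<^sub>0 'a) set \<Rightarrow> ('g list \<Rightarrow>\<^sub>0 'a) set" where
  "ad_SN kscale gscale br anchor P = (\<lambda>R. schouten_bracket kscale gscale br anchor P R)"

text \<open>The degrees are integers, since \<open>ad_SN P\<close> has degree \<open>-1\<close> for \<open>P\<close> of degree \<open>0\<close>.\<close>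

definition graded_commutator ::
    "('k::field_char_0 \<Rightarrow> 'a::{comm_ring,comm_monoid_mult} \<Rightarrow> 'a) \<Rightarrow>
     ('a \<Rightarrow> 'g::ab_group_add \<Rightarrow> 'g) \<Rightarrow> int \<Rightarrow> int \<Rightarrow>
     (('g list \<Rightarrow>\<^sub>0 'a) set \<Rightarrow> ('g list \<Rightarrow>\<^sub>0 'a) set) \<Rightarrow>
     (('g list \<Rightarrow>\<^sub>0 'a) set \<Rightarrow> ('g list \<Rightarrow>\<^sub>0 'a) set) \<Rightarrow>
     ('g list \<Rightarrow>\<^sub>0 'a) set \<Rightarrow> ('g list \<Rightarrow>\<^sub>0 'a) set" where
  "graded_commutator kscale gscale d1 d2 D1 D2 =
     (\<lambda>R. ext_diff gscale ((D1 \<circ> D2) R)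
            (ext_kscale kscale gscale ((-1) powi (d1 * d2)) ((D2 \<circ> D1) R)))"

end

(*
  Modulo the relations, the bracket of a fixed multivector P with R is a graded derivation of R,
  and it is graded antisymmetric. The graded Jacobi defect of (P, Q, R) is therefore a graded
  derivation in R that is, up to sign, invariant under permutations of the three arguments, so it
  vanishes as soon as it vanishes for arguments in A and G; there it is the Jacobi identity of G,
  respectively the compatibility of the anchor with brackets.
  To have an honest function to compute with, the bracket is first defined on the free associative
  algebra on G over A by the recursion
    [x w, g] = x [w, g] + (-1)^(length w) w (L_x g),
  where L_x is the Lie derivative along x, and is then shown to preserve the relations.
*)
theory Submission
  imports Defs
begin

text \<open>The bracket is K-bilinear but not A-bilinear, so values on words with coefficient 1 do
  not extend by pulling coefficients out. In the free algebra a word with coefficient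
  \<open>a\<close> is the product of its letters with \<open>scalar a\<close> at the far right.
  Peeling off letters from the left leaves the coefficient itself as last factor, and it is
  bracketed as an element of degree 0. Before passing to the quotient, distinct letters neither
  anticommute nor obey any linear relation, so the Leibniz rule, antisymmetry and the Jacobi
  identity hold in general only modulo the ideal. Each becomes a membership statement, proved by
  writing the element as an explicit combination of members already known. The inductions pass
  through sums, so the argument inducted over cannot be assumed homogeneous. Its degree signs are
  carried by the grade involution, and at most the other arguments are homogeneous.\<close>

section \<open>The free algebra and its relations\<close>

text \<open>
  Words form a monoid under concatenation, so the convolution product of the library turns the
  free module on words into the free associative algebra.
\<close>

instantiation list :: (type) monoid_add
begin

definition zero_list :: "'a list" where "zero_list = []"
definition plus_list :: "'a list \<Rightarrow> 'a list \<Rightarrow> 'a list" where "plus_list xs ys = xs @ ys"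

instance
  by standard (simp_all add: zero_list_def plus_list_def)

end

definition scalar :: "'a::{comm_ring,comm_monoid_mult} \<Rightarrow> 'g list \<Rightarrow>\<^sub>0 'a" where
  "scalar a = Poly_Mapping.single [] a"

definition gen :: "'g \<Rightarrow> 'g list \<Rightarrow>\<^sub>0 'a::{comm_ring,comm_monoid_mult}" where
  "gen x = Poly_Mapping.single [x] 1"

lemma single_Nil: "Poly_Mapping.single [] a = scalar a"
  by (simp add: scalar_def)

lemma single_Cons: "Poly_Mapping.single (x # w) a = gen x * Poly_Mapping.single w a"
  by (simp add: gen_def mult_single plus_list_def)

lemma single_append:
  fixes a :: "'a::{comm_ring,comm_monoid_mult}"
  shows "Poly_Mapping.single (u @ v) a = Poly_Mapping.single u 1 * Poly_Mapping.single v a"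
  by (simp add: mult_single plus_list_def)

lemma scalar_mult_single: "scalar a * Poly_Mapping.single w b = Poly_Mapping.single w (a * b)"
  by (simp add: scalar_def mult_single plus_list_def)

lemma scalar_0 [simp]: "scalar 0 = 0"
  by (simp add: scalar_def)

lemma scalar_add: "scalar (a + b) = scalar a + scalar b"
  by (simp add: scalar_def single_add)

lemma scalar_diff: "scalar (a - b) = scalar a - scalar b"
  by (simp add: scalar_def single_diff)

lemma scalar_uminus: "scalar (- a) = - scalar a"
  by (simp add: scalar_def single_uminus)

lemma scalar_mult: "scalar (a * b) = scalar a * scalar b"
  by (simp add: scalar_def mult_single plus_list_def)

lemma single_induct [case_names single add]:
  fixes f :: "'w \<Rightarrow>\<^sub>0 'a::comm_monoid_add"
  assumes single: "\<And>w a. P (Poly_Mapping.single w a)"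
    and add: "\<And>f g. P f \<Longrightarrow> P g \<Longrightarrow> P (f + g)"
  shows "P f"
proof (induction f rule: update_induct)
  case const
  \<comment> \<open>A monomial with coefficient 0 is the zero element, whatever its word, so the
    base case needs no hypothesis of its own.\<close>
  show ?case using single[of undefined 0] by simp
next
  case (update f w a)
  have "Poly_Mapping.update w a f = f + Poly_Mapping.single w a"
    using update.hyps(1)
    by (intro poly_mapping_eqI)
      (auto simp: lookup_update lookup_add lookup_single when_def in_keys_iff)
  then show ?case
    using add[OF update.IH single] by simp
qed

text \<open>Matches the recursions below: letters are split off on the left until only the
  coefficient remains.\<close>

lemma free_induct [case_names scalar gen add]:
  fixes f :: "'g list \<Rightarrow>\<^sub>0 'a::{comm_ring,comm_monoid_mult}"
  assumes scalar: "\<And>a. P (scalar a)"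
    and gen: "\<And>x f. P f \<Longrightarrow> P (gen x * f)"
    and add: "\<And>f g. P f \<Longrightarrow> P g \<Longrightarrow> P (f + g)"
  shows "P f"
proof (induction f rule: single_induct)
  case (single w a)
  show ?case
    by (induction w) (simp_all add: single_Nil single_Cons scalar gen)
qed (rule add)

lemma scalar_central: "f * scalar a = scalar a * f"
proof (induction f rule: free_induct)
  case (scalar b)
  show ?case by (simp add: scalar_mult[symmetric] mult.commute)
next
  case (gen x f)
  have *: "gen x * scalar a = scalar a * gen x"
    by (simp add: gen_def scalar_def mult_single plus_list_def)
  have "gen x * f * scalar a = gen x * scalar a * f"
    by (simp add: mult.assoc gen)
  then show ?case by (simp only: * mult.assoc)
qed (simp add: algebra_simps)

lemma scalar_1_mult [simp]: "scalar 1 * f = f" "f * scalar 1 = f"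
proof -
  show *: "scalar 1 * f = f"
  proof (induction f rule: free_induct)
    case (gen x f)
    have "scalar 1 * (gen x * f) = gen x * scalar 1 * f"
      by (simp only: scalar_central mult.assoc)
    then show ?case by (simp only: gen mult.assoc)
  qed (simp_all add: algebra_simps scalar_mult[symmetric])
  show "f * scalar 1 = f" by (simp add: scalar_central *)
qed

lemma scalar_left_commute: "f * (scalar a * g) = scalar a * (f * g)"
  by (simp only: scalar_central[of f a] flip: mult.assoc)

lemma scalar_gen_simps:
  "gen x * scalar a = scalar a * gen x" "gen x * (scalar a * f) = scalar a * (gen x * f)"
  "scalar a * scalar b = scalar b * scalar a"
  "scalar a * (scalar b * f) = scalar b * (scalar a * f)"
  by (rule scalar_central scalar_left_commute)+

text \<open>Multiplication by \<open>(- 1) ^ n\<close>; the coefficient type is not in class \<open>ring_1\<close>.\<close>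

definition sgn_pow :: "nat \<Rightarrow> 'b::ab_group_add \<Rightarrow> 'b" where
  "sgn_pow n f = (if even n then f else - f)"

text \<open>The coefficient is handed to the function on words instead of being factored out,
  because derivations also differentiate coefficients. The extension is additive as soon as the
  function is additive in the coefficient.\<close>

definition lin_ext :: "('g list \<Rightarrow> 'a::{comm_ring,comm_monoid_mult} \<Rightarrow> 'b::ab_group_add) \<Rightarrow>
    ('g list \<Rightarrow>\<^sub>0 'a) \<Rightarrow> 'b" where
  "lin_ext \<phi> f = (\<Sum>w\<in>Poly_Mapping.keys f. \<phi> w (Poly_Mapping.lookup f w))"

lemma lin_ext_single:
  assumes "\<And>a b. \<phi> w (a + b) = \<phi> w a + \<phi> w b"
  shows "lin_ext \<phi> (Poly_Mapping.single w a) = \<phi> w a"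
proof -
  have "\<phi> w 0 = 0" using assms[of 0 0] by simp
  then show ?thesis by (simp add: lin_ext_def)
qed

lemma lin_ext_add:
  assumes "\<And>w a b. \<phi> w (a + b) = \<phi> w a + \<phi> w b"
  shows "lin_ext \<phi> (f + g) = lin_ext \<phi> f + lin_ext \<phi> g"
  unfolding lin_ext_def
proof (rule setsum_keys_plus_distrib)
  show "\<phi> w 0 = 0" for w using assms[of w 0 0] by simp
qed (simp add: assms)

text \<open>The main involution of the tensor algebra. It encodes a sign (-1)^degree as an additive,
  multiplicative map, so that signs make sense for inhomogeneous elements.\<close>

definition grade_inv :: "('g list \<Rightarrow>\<^sub>0 'a) \<Rightarrow> ('g list \<Rightarrow>\<^sub>0 'a::{comm_ring,comm_monoid_mult})" where
  "grade_inv = lin_ext (\<lambda>w a. sgn_pow (length w) (Poly_Mapping.single w a))"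

lemma grade_inv_add: "grade_inv (f + g) = grade_inv f + grade_inv g"
  unfolding grade_inv_def by (rule lin_ext_add) (simp add: sgn_pow_def single_add)

lemma grade_inv_single:
  "grade_inv (Poly_Mapping.single w a) = sgn_pow (length w) (Poly_Mapping.single w a)"
  unfolding grade_inv_def by (rule lin_ext_single) (simp add: sgn_pow_def single_add)

interpretation grade_inv: additive grade_inv
  by standard (rule grade_inv_add)

lemma grade_inv_scalar [simp]: "grade_inv (scalar a) = scalar a"
  using grade_inv_single[of "[]" a] by (simp add: single_Nil sgn_pow_def)

lemma grade_inv_gen_mult [simp]: "grade_inv (gen x * f) = - (gen x * grade_inv f)"
proof (induction f rule: single_induct)
  case (single w a)
  show ?case
    by (simp add: single_Cons[symmetric] grade_inv_single) (simp add: single_Cons sgn_pow_def)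
qed (simp add: distrib_left grade_inv_add)

lemma grade_inv_scalar_mult [simp]: "grade_inv (scalar a * f) = scalar a * grade_inv f"
proof (induction f rule: free_induct)
  case (gen x f)
  then show ?case by (simp add: scalar_left_commute[symmetric])
qed (simp_all add: distrib_left grade_inv_add scalar_mult[symmetric])

lemma grade_inv_mult: "grade_inv (f * g) = grade_inv f * grade_inv g"
proof (induction f rule: free_induct)
  case (gen x f)
  then show ?case by (simp add: mult.assoc)
qed (simp_all add: distrib_right grade_inv_add)

lemma grade_inv_gen [simp]: "grade_inv (gen x) = - gen x"
  using grade_inv_gen_mult[of x "scalar 1"] by simp

lemma grade_inv_grade_inv [simp]: "grade_inv (grade_inv f) = f"
  by (induction f rule: free_induct) (simp_all add: grade_inv_add grade_inv.minus)

section \<open>The ideal of relations and operators that preserve it\<close>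

context
  fixes gscale :: "'a::{comm_ring,comm_monoid_mult} \<Rightarrow> 'g::ab_group_add \<Rightarrow> 'g"
begin

private abbreviation "rels \<equiv> ext_ideal gscale"

lemma ideal_uminus: "f \<in> rels \<Longrightarrow> - f \<in> rels"
  using ext_ideal.diff[OF ext_ideal.zero] by fastforce

lemma ideal_add: "f \<in> rels \<Longrightarrow> g \<in> rels \<Longrightarrow> f + g \<in> rels"
  using ext_ideal.diff[OF _ ideal_uminus] by fastforce

lemma ideal_sum: "(\<And>i. i \<in> S \<Longrightarrow> f i \<in> rels) \<Longrightarrow> sum f S \<in> rels"
  by (induction S rule: infinite_finite_induct) (auto intro: ideal_add ext_ideal.zero)

lemma ideal_sgn_pow: "f \<in> rels \<Longrightarrow> sgn_pow n f \<in> rels"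
  by (simp add: sgn_pow_def ideal_uminus)

lemma ideal_mult_single_left: "f \<in> rels \<Longrightarrow> Poly_Mapping.single w c * f \<in> rels"
proof (induction rule: ext_ideal.induct)
  case (additive u x y v a)
  then show ?case
    using ext_ideal.additive[of "w @ u" x y v "c * a" gscale]
    by (simp add: algebra_simps mult_single plus_list_def)
next
  case (homogeneous u b x v a)
  then show ?case
    using ext_ideal.homogeneous[of "w @ u" gscale b x v "c * a"]
    by (simp add: algebra_simps mult_single plus_list_def)
next
  case (alternating u x v a)
  then show ?case
    using ext_ideal.alternating[of "w @ u" x v "c * a" gscale]
    by (simp add: algebra_simps mult_single plus_list_def)
qed (auto simp: algebra_simps intro: ext_ideal.zero ext_ideal.diff)

lemma ideal_mult_single_right: "f \<in> rels \<Longrightarrow> f * Poly_Mapping.single w c \<in> rels"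
proof (induction rule: ext_ideal.induct)
  case (additive u x y v a)
  then show ?case
    using ext_ideal.additive[of u x y "v @ w" "a * c" gscale]
    by (simp add: algebra_simps mult_single plus_list_def)
next
  case (homogeneous u b x v a)
  then show ?case
    using ext_ideal.homogeneous[of u gscale b x "v @ w" "a * c"]
    by (simp add: algebra_simps mult_single plus_list_def)
next
  case (alternating u x v a)
  then show ?case
    using ext_ideal.alternating[of u x "v @ w" "a * c" gscale]
    by (simp add: algebra_simps mult_single plus_list_def)
qed (auto simp: algebra_simps intro: ext_ideal.zero ext_ideal.diff)

lemma ideal_mult_left: "f \<in> rels \<Longrightarrow> g * f \<in> rels"
  by (induction g rule: single_induct)
    (auto simp: distrib_right intro: ideal_mult_single_left ideal_add)

lemma ideal_mult_right: "f \<in> rels \<Longrightarrow> f * g \<in> rels"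
  by (induction g rule: single_induct)
    (auto simp: distrib_left intro: ideal_mult_single_right ideal_add)

lemmas ideal_diff = ext_ideal.diff

text \<open>Shape of most membership proofs below: \<open>r\<close> is assembled with
  \<open>OF\<close> from known members, and ring normalisation settles the equation.\<close>

lemma ideal_eqI: "r \<in> rels \<Longrightarrow> f = r \<Longrightarrow> f \<in> rels"
  by simp

lemma gen_add_mem: "gen (x + y) * f - gen x * f - gen y * f \<in> rels"
proof -
  have "gen (x + y) - gen x - gen y \<in> rels"
    using ext_ideal.additive[of "[]" x y "[]" 1 gscale] by (simp add: gen_def)
  from ideal_mult_right[OF this, of f] show ?thesis by (simp add: algebra_simps)
qed

lemma gen_gscale_mem: "gen (gscale b x) * f - scalar b * gen x * f \<in> rels"
proof -
  have "gen (gscale b x) - scalar b * gen x \<in> rels"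
    using ext_ideal.homogeneous[of "[]" gscale b x "[]" 1]
    by (simp add: gen_def scalar_mult_single)
  from ideal_mult_right[OF this, of f] show ?thesis by (simp add: algebra_simps)
qed

lemma gen_gen_mem: "gen x * (gen x * f) \<in> rels"
proof -
  have "gen x * gen x \<in> rels"
    using ext_ideal.alternating[of "[]" x "[]" 1 gscale]
    by (simp add: gen_def mult_single plus_list_def)
  from ideal_mult_right[OF this, of f] show ?thesis by (simp add: algebra_simps)
qed

text \<open>Polarisation: the mixed terms remain when the squares of \<open>x\<close> and of
  \<open>y\<close> are removed from the square of \<open>x + y\<close>.\<close>

lemma gen_anticommute_mem: "gen x * (gen y * f) + gen y * (gen x * f) \<in> rels"
proof -
  have xy: "gen (x + y) * (gen (x + y) * f) \<in> rels" and x: "gen x * (gen x * f) \<in> rels"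
    and y: "gen y * (gen y * f) \<in> rels"
    by (rule gen_gen_mem)+
  note l = gen_add_mem[of x y "gen (x + y) * f"] and r = gen_add_mem[of x y f]
  show ?thesis
    by (rule ideal_eqI[OF ideal_diff[OF ideal_diff[OF ideal_diff[OF xy l]
            ideal_add[OF ideal_mult_left[OF r, of "gen x"] ideal_mult_left[OF r, of "gen y"]]]
            ideal_add[OF x y]]])
      (simp add: algebra_simps)
qed

lemma gen_commute_mem: "gen x * f - grade_inv f * gen x \<in> rels"
proof (induction f rule: free_induct)
  case (scalar a)
  show ?case by (simp add: scalar_central ext_ideal.zero)
next
  case (gen y f)
  show ?case
    by (rule ideal_eqI[OF ideal_diff[OF gen_anticommute_mem[of x y f]
            ideal_mult_left[OF gen, of "gen y"]]])
      (simp add: algebra_simps)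
next
  case (add f g)
  show ?case
    by (rule ideal_eqI[OF ideal_add[OF add]]) (simp add: algebra_simps grade_inv_add)
qed

text \<open>Criterion for an operator to descend to the quotient. The hypothesis \<open>gen\<close>
  takes care of the prefix \<open>u\<close> of a relation, letter by letter, so only relations at
  the front of a word have to be checked. In \<open>homogeneous\<close> the scalar stays inside
  \<open>T\<close>, since \<open>T\<close> need not be A-linear.\<close>

lemma ideal_preserved:
  assumes T: "additive T" and f: "f \<in> rels"
    and gen: "\<And>z f. f \<in> rels \<Longrightarrow> T f \<in> rels \<Longrightarrow> T (gen z * f) \<in> rels"
    and additive: "\<And>x y f. T (gen (x + y) * f) - T (gen x * f) - T (gen y * f) \<in> rels"
    and homogeneous: "\<And>b x f. T (gen (gscale b x) * f) - T (gen x * (scalar b * f)) \<in> rels"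
    and alternating: "\<And>x f. T (gen x * (gen x * f)) \<in> rels"
  shows "T f \<in> rels"
proof -
  interpret additive T by fact
  have word: "T (Poly_Mapping.single u 1 * g) \<in> rels" if "g \<in> rels" "T g \<in> rels" for u g
  proof (induction u)
    case (Cons z u)
    have "Poly_Mapping.single u 1 * g \<in> rels" using that by (intro ideal_mult_left)
    from gen[OF this Cons.IH, of z] show ?case by (simp add: single_Cons mult.assoc)
  qed (use that in \<open>simp add: single_Nil\<close>)
  from f show ?thesis
  proof (induction rule: ext_ideal.induct)
    case (additive u x y v a)
    have "T (Poly_Mapping.single u 1 * (gen (x + y) * Poly_Mapping.single v a
        - gen x * Poly_Mapping.single v a - gen y * Poly_Mapping.single v a)) \<in> rels"
      by (rule word) (simp_all add: gen_add_mem diff assms(4))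
    then show ?case
      by (simp add: single_append[of u] single_Cons right_diff_distrib)
  next
    case (homogeneous u b x v a)
    have "T (Poly_Mapping.single u 1 * (gen (gscale b x) * Poly_Mapping.single v a
        - gen x * (scalar b * Poly_Mapping.single v a))) \<in> rels"
      using gen_gscale_mem[of b x "Poly_Mapping.single v a"]
      using assms(5)[of b x "Poly_Mapping.single v a"]
      by (intro word) (simp_all add: diff scalar_left_commute mult.assoc)
    then show ?case
      by (simp add: single_append[of u] single_Cons right_diff_distrib scalar_mult_single
          mult.commute[of a b])
  next
    case (alternating u x v a)
    have "T (Poly_Mapping.single u 1 * (gen x * (gen x * Poly_Mapping.single v a))) \<in> rels"
      by (rule word) (simp_all add: gen_gen_mem assms(6))
    then show ?case
      by (simp add: single_append[of u] single_Cons)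
  qed (simp_all add: zero diff ext_ideal.zero ext_ideal.diff)
qed

lemma grade_inv_ideal: "f \<in> rels \<Longrightarrow> grade_inv f \<in> rels"
proof (rule ideal_preserved[OF grade_inv.additive_axioms])
  fix x y b and f :: "'g list \<Rightarrow>\<^sub>0 'a"
  show "grade_inv (gen (x + y) * f) - grade_inv (gen x * f) - grade_inv (gen y * f) \<in> rels"
    using ideal_uminus[OF gen_add_mem[of x y "grade_inv f"]] by (simp add: algebra_simps)
  show "grade_inv (gen (gscale b x) * f) - grade_inv (gen x * (scalar b * f)) \<in> rels"
    using ideal_uminus[OF gen_gscale_mem[of b x "grade_inv f"]]
    by (simp add: algebra_simps scalar_left_commute)
qed (auto simp: grade_inv.minus gen_gen_mem intro: ideal_uminus ideal_mult_left)

end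

lemma sgn_pow_ring_simps:
  fixes f g :: "'r::ring"
  shows "sgn_pow n (f + g) = sgn_pow n f + sgn_pow n g" "sgn_pow n f * g = sgn_pow n (f * g)"
    "f * sgn_pow n g = sgn_pow n (f * g)" "sgn_pow m (sgn_pow n f) = sgn_pow (m + n) f"
  by (auto simp: sgn_pow_def)

text \<open>Only the parity of the degree is recorded.\<close>

definition homog :: "nat \<Rightarrow> ('g list \<Rightarrow>\<^sub>0 'a::{comm_ring,comm_monoid_mult}) \<Rightarrow> bool" where
  "homog n f \<longleftrightarrow> grade_inv f = sgn_pow n f"

lemma homog_scalar: "homog 0 (scalar a)"
  by (simp add: homog_def sgn_pow_def)

lemma homog_gen: "homog 1 (gen x)"
  by (simp add: homog_def sgn_pow_def)

text \<open>The n-fold grade involution: the Koszul sign for moving \<open>f\<close>, of unknown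
  degree, past something of degree \<open>n\<close>.\<close>

definition twist :: "nat \<Rightarrow> ('g list \<Rightarrow>\<^sub>0 'a) \<Rightarrow> ('g list \<Rightarrow>\<^sub>0 'a::{comm_ring,comm_monoid_mult})" where
  "twist n f = (if even n then f else grade_inv f)"

lemma homog_twist: "homog m f \<Longrightarrow> twist n f = sgn_pow (n * m) f"
  by (auto simp: homog_def twist_def sgn_pow_def)

text \<open>Graded commutativity of the wedge product: the letters of \<open>f\<close> cross
  \<open>g\<close> one by one, each contributing (-1)^q.\<close>

lemma commute_homog_mem:
  assumes "homog q g"
  shows "f * g - g * twist q f \<in> ext_ideal gscale"
proof (induction f rule: free_induct)
  case (scalar a)
  show ?case by (simp add: twist_def scalar_central ext_ideal.zero)
next
  case (gen x f)
  show ?case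
    by (rule ideal_eqI[OF ideal_add[OF ideal_mult_left[OF gen, of "gen x"]
            ideal_mult_right[OF gen_commute_mem[of x g gscale], of "twist q f"]]])
      (use assms in \<open>simp add: homog_def twist_def sgn_pow_def algebra_simps\<close>)
next
  case (add f h)
  show ?case
    by (rule ideal_eqI[OF ideal_add[OF add]])
      (simp add: twist_def grade_inv_add algebra_simps)
qed

section \<open>Computing with classes through representatives\<close>

lemma ext_class_eq_iff: "ext_class gscale f = ext_class gscale g \<longleftrightarrow> f - g \<in> ext_ideal gscale"
proof
  assume eq: "ext_class gscale f = ext_class gscale g"
  have "f \<in> ext_class gscale f" by (simp add: ext_class_def ext_ideal.zero)
  then have "f \<in> ext_class gscale g" by (simp only: eq)
  then show "f - g \<in> ext_ideal gscale" by (simp add: ext_class_def)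
next
  assume fg: "f - g \<in> ext_ideal gscale"
  have "h - g \<in> ext_ideal gscale" if "h - f \<in> ext_ideal gscale" for h
    by (rule ideal_eqI[OF ideal_add[OF that fg]]) (simp add: algebra_simps)
  moreover have "h - f \<in> ext_ideal gscale" if "h - g \<in> ext_ideal gscale" for h
    by (rule ideal_eqI[OF ideal_diff[OF that fg]]) (simp add: algebra_simps)
  ultimately show "ext_class gscale f = ext_class gscale g" unfolding ext_class_def by blast
qed

text \<open>Operations on classes are unions over all representatives; once the result is
  independent of the representative, the union collapses to a single value.\<close>

lemma ext_class_UN:
  assumes "\<And>f'. f' - f \<in> ext_ideal gscale \<Longrightarrow> H f' = H f"
  shows "(\<Union>f'\<in>ext_class gscale f. H f') = H f"
proof -
  have "f \<in> ext_class gscale f" by (simp add: ext_class_def ext_ideal.zero)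
  moreover have "H f' = H f" if "f' \<in> ext_class gscale f" for f'
    using that by (intro assms) (simp add: ext_class_def)
  ultimately show ?thesis by blast
qed

lemma ext_add_class: "ext_add gscale (ext_class gscale f) (ext_class gscale g) = ext_class gscale (f + g)"
  unfolding ext_add_def
  by (subst ext_class_UN; (subst ext_class_UN)?; simp add: ext_class_eq_iff algebra_simps)

lemma ext_diff_class: "ext_diff gscale (ext_class gscale f) (ext_class gscale g) = ext_class gscale (f - g)"
  unfolding ext_diff_def
  by (subst ext_class_UN; (subst ext_class_UN)?)
    (auto simp: ext_class_eq_iff algebra_simps dest: ideal_uminus)

lemma lin_ext_id: "lin_ext Poly_Mapping.single f = f"
  by (induction f rule: single_induct) (simp_all add: lin_ext_single lin_ext_add single_add)

lemma homog_length:
  assumes "\<And>w. w \<in> Poly_Mapping.keys f \<Longrightarrow> even (length w) = even n"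
  shows "homog n f"
proof -
  have "grade_inv f = (\<Sum>w\<in>Poly_Mapping.keys f. sgn_pow n (Poly_Mapping.single w (Poly_Mapping.lookup f w)))"
    unfolding grade_inv_def lin_ext_def using assms
    by (intro sum.cong) (simp_all add: sgn_pow_def)
  also have "\<dots> = sgn_pow n (lin_ext Poly_Mapping.single f)"
    by (simp add: sgn_pow_def lin_ext_def sum_negf)
  finally show ?thesis by (simp add: homog_def lin_ext_id)
qed

lemma omit_nth_Cons: "omit_nth (x # xs) (Suc 0) = xs"
  "i \<ge> 1 \<Longrightarrow> omit_nth (x # xs) (Suc i) = x # omit_nth xs i"
  by (cases i; simp add: omit_nth_def)+

lemma nth_Cons_shift: "i \<ge> 1 \<Longrightarrow> (x # xs) ! i = xs ! (i - 1)"
  by (cases i) simp_all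

lemma sum_one_upto_Suc: "(\<Sum>i = Suc 0..Suc n. h i) = h (Suc 0) + (\<Sum>i = Suc 0..n. h (Suc i))"
  by (simp add: sum.atLeast_Suc_atMost sum.atLeast_Suc_atMost_Suc_shift del: sum.cl_ivl_Suc)

section \<open>The bracket on the free algebra\<close>

context lie_rinehart
begin

abbreviation "rels \<equiv> ext_ideal gscale"

lemma anchor_add_right: "anchor x (a + b) = anchor x a + anchor x b"
  and anchor_kscale: "anchor x (kscale c a) = kscale c (anchor x a)"
  and anchor_mult: "anchor x (a * b) = anchor x a * b + a * anchor x b"
proof -
  interpret Vector_Spaces.linear kscale kscale "anchor x"
    using anchor_derivation by (simp add: k_derivation_def)
  show "anchor x (a + b) = anchor x a + anchor x b" by (rule add)
  show "anchor x (kscale c a) = kscale c (anchor x a)" by (rule scale)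
  show "anchor x (a * b) = anchor x a * b + a * anchor x b"
    using anchor_derivation by (simp add: k_derivation_def)
qed

interpretation anchor: additive "anchor x" for x
  by standard (rule anchor_add_right)

text \<open>Derivations kill constants. This is the source of K-linearity for operators that are not
  A-linear.\<close>

lemma anchor_kscale_one: "anchor x (kscale c 1) = 0"
proof -
  have "anchor x 1 = 0" using anchor_mult[of x 1 1] by simp
  then show ?thesis by (simp add: anchor_kscale)
qed

lemma br_add_left: "br (x + y) z = br x z + br y z"
proof -
  interpret Vector_Spaces.linear "\<lambda>c. gscale (kscale c 1)" "\<lambda>c. gscale (kscale c 1)" "\<lambda>x. br x z"
    by (rule lie.br_linear_left)
  show ?thesis by (rule add)
qed

lemma br_add_right: "br x (y + z) = br x y + br x z"
proof -
  interpret Vector_Spaces.linear "\<lambda>c. gscale (kscale c 1)" "\<lambda>c. gscale (kscale c 1)" "br x"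
    by (rule lie.br_linear_right)
  show ?thesis by (rule add)
qed

lemma br_anticommute: "br y x = - br x y"
proof -
  have "br x y + br y x = br (x + y) (x + y) - br x x - br y y"
    by (simp add: br_add_left br_add_right)
  then show ?thesis by (simp add: lie.br_self eq_neg_iff_add_eq_0 add.commute)
qed

interpretation gscale: additive "gscale a" for a
  by standard (rule gscale_add_right)

interpretation gscale_left: additive "\<lambda>a. gscale a x" for x
  by standard (rule gscale_add_left)

interpretation br: additive "br x" for x
  by standard (rule br_add_right)

lemma br_gscale_left: "br (gscale b x) y = gscale b (br x y) - gscale (anchor y b) x"
  using br_gscale[of y b x] br_anticommute[of "gscale b x" y] br_anticommute[of x y]
  by (simp add: gscale.minus)

lemma gen_uminus_mem: "gen (- x) * f + gen x * f \<in> rels"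
proof -
  have "gen 0 * f \<in> rels"
    using ideal_uminus[OF gen_add_mem[of 0 0 f gscale]] by simp
  from ideal_diff[OF this gen_add_mem[of x "- x" f gscale]] show ?thesis
    by (simp add: algebra_simps)
qed

section \<open>Lie derivative and contraction on the free algebra\<close>

primrec lie_der_word :: "'g \<Rightarrow> 'g list \<Rightarrow> 'a \<Rightarrow> 'g list \<Rightarrow>\<^sub>0 'a" where
  "lie_der_word x [] b = scalar (anchor x b)"
| "lie_der_word x (y # w) b = gen (br x y) * Poly_Mapping.single w b + gen y * lie_der_word x w b"

definition lie_der :: "'g \<Rightarrow> ('g list \<Rightarrow>\<^sub>0 'a) \<Rightarrow> ('g list \<Rightarrow>\<^sub>0 'a)" where
  "lie_der x = lin_ext (lie_der_word x)"

lemma lie_der_word_add: "lie_der_word x w (a + b) = lie_der_word x w a + lie_der_word x w b"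
  by (induction w) (simp_all add: scalar_add anchor.add single_add distrib_left)

lemma lie_der_add: "lie_der x (f + g) = lie_der x f + lie_der x g"
  unfolding lie_der_def by (rule lin_ext_add) (rule lie_der_word_add)

interpretation lie_der: additive "lie_der x" for x
  by standard (rule lie_der_add)

lemma lie_der_single: "lie_der x (Poly_Mapping.single w a) = lie_der_word x w a"
  unfolding lie_der_def by (rule lin_ext_single) (rule lie_der_word_add)

lemma lie_der_scalar [simp]: "lie_der x (scalar a) = scalar (anchor x a)"
  using lie_der_single[of x "[]" a] by (simp add: single_Nil)

lemma lie_der_gen [simp]: "lie_der x (gen y * f) = gen (br x y) * f + gen y * lie_der x f"
proof (induction f rule: single_induct)
  case (single w a)
  show ?case by (simp add: lie_der_single single_Cons[symmetric])
qed (simp add: distrib_left lie_der_add algebra_simps)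

lemma lie_der_scalar_mult [simp]:
  "lie_der x (scalar b * f) = scalar (anchor x b) * f + scalar b * lie_der x f"
proof (induction f rule: free_induct)
  case (scalar a)
  show ?case by (simp add: scalar_mult[symmetric] scalar_add[symmetric] anchor_mult)
next
  case (gen y f)
  have "lie_der x (scalar b * (gen y * f)) = lie_der x (gen y * (scalar b * f))"
    by (simp only: scalar_left_commute)
  also have "\<dots> = scalar (anchor x b) * (gen y * f) + scalar b * lie_der x (gen y * f)"
    by (simp only: lie_der_gen gen) (simp add: distrib_left scalar_gen_simps)
  finally show ?case .
qed (simp add: distrib_left lie_der_add)

text \<open>\<open>contr a\<close> is the interior product with \<open>- d a\<close>, that is, the bracket \<open>[a, _]\<close>.\<close>

primrec contr_word :: "'a \<Rightarrow> 'g list \<Rightarrow> 'a \<Rightarrow> 'g list \<Rightarrow>\<^sub>0 'a" where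
  "contr_word a [] b = 0"
| "contr_word a (y # w) b =
     - (scalar (anchor y a) * Poly_Mapping.single w b) - gen y * contr_word a w b"

definition contr :: "'a \<Rightarrow> ('g list \<Rightarrow>\<^sub>0 'a) \<Rightarrow> ('g list \<Rightarrow>\<^sub>0 'a)" where
  "contr a = lin_ext (contr_word a)"

lemma contr_word_add: "contr_word c w (a + b) = contr_word c w a + contr_word c w b"
  by (induction w) (simp_all add: single_add algebra_simps)

lemma contr_add: "contr a (f + g) = contr a f + contr a g"
  unfolding contr_def by (rule lin_ext_add) (rule contr_word_add)

interpretation contr: additive "contr a" for a
  by standard (rule contr_add)

lemma contr_single: "contr a (Poly_Mapping.single w b) = contr_word a w b"
  unfolding contr_def by (rule lin_ext_single) (rule contr_word_add)

lemma contr_scalar [simp]: "contr a (scalar b) = 0"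
  using contr_single[of a "[]" b] by (simp add: single_Nil)

lemma contr_gen [simp]: "contr a (gen y * f) = - (scalar (anchor y a) * f) - gen y * contr a f"
proof (induction f rule: single_induct)
  case (single w b)
  show ?case by (simp add: contr_single single_Cons[symmetric])
qed (simp add: distrib_left contr_add algebra_simps)

lemma contr_scalar_mult [simp]: "contr a (scalar b * f) = scalar b * contr a f"
proof (induction f rule: free_induct)
  case (gen y f)
  have "contr a (scalar b * (gen y * f)) = contr a (gen y * (scalar b * f))"
    by (simp only: scalar_left_commute)
  also have "\<dots> = scalar b * contr a (gen y * f)"
    by (simp only: contr_gen gen) (simp add: right_diff_distrib scalar_gen_simps)
  finally show ?case .
qed (simp_all add: distrib_left contr_add scalar_mult[symmetric])

lemma contr_add_scalar: "contr (a + b) f = contr a f + contr b f"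
  by (induction f rule: free_induct)
    (simp_all add: contr_add anchor.add scalar_add algebra_simps)

lemma contr_mult: "contr (a * b) f = scalar a * contr b f + scalar b * contr a f"
  by (induction f rule: free_induct)
    (simp_all add: contr_add anchor_mult scalar_add scalar_mult algebra_simps scalar_gen_simps)

lemma contr_const: "(\<And>x. anchor x a = 0) \<Longrightarrow> contr a f = 0"
  by (induction f rule: free_induct) (simp_all add: contr_add)

text \<open>Not an equality in the free algebra, because \<open>br (x + y) z\<close> enters as one
  single letter.\<close>

lemma lie_der_add_gen_mem: "lie_der (x + y) f - lie_der x f - lie_der y f \<in> rels"
proof (induction f rule: free_induct)
  case (scalar a)
  show ?case by (simp add: anchor_add scalar_add ext_ideal.zero)
next
  case (gen z f)
  show ?case
    by (rule ideal_eqI[OF ideal_add[OF gen_add_mem[of "br x z" "br y z" f]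
            ideal_mult_left[OF gen, of "gen z"]]])
      (simp add: algebra_simps br_add_left)
next
  case (add f g)
  show ?case by (rule ideal_eqI[OF ideal_add[OF add]]) (simp add: lie_der_add algebra_simps)
qed

text \<open>Measures how far the Lie derivative is from being A-linear in the vector. The extra term
  in \<open>[b x, z] = b [x, z] - rho(z)(b) x\<close> replaces the letter \<open>z\<close> by
  \<open>x\<close>, and this is what \<open>contr b\<close> followed by left multiplication with
  \<open>x\<close> does, up to the sign of moving \<open>x\<close> to the front.\<close>

lemma lie_der_gscale_mem:
  "lie_der (gscale b x) f - scalar b * lie_der x f - gen x * contr b f \<in> rels"
proof (induction f rule: free_induct)
  case (scalar a)
  show ?case by (simp add: anchor_gscale scalar_mult ext_ideal.zero)
next
  case (gen z f)
  have br: "br (gscale b x) z = gscale b (br x z) + gscale (- anchor z b) x"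
    by (simp add: br_gscale_left gscale_left.minus)
  show ?case
    by (rule ideal_eqI[OF ideal_add[OF ideal_add[OF ideal_add[OF
              gen_add_mem[of "gscale b (br x z)" "gscale (- anchor z b) x" f]
              gen_gscale_mem[of gscale b "br x z" f]] gen_gscale_mem[of gscale "- anchor z b" x f]]
            ideal_diff[OF ideal_mult_left[OF gen, of "gen z"]
              ideal_uminus[OF gen_anticommute_mem[of x z "contr b f"]]]]])
      (simp add: br algebra_simps scalar_gen_simps scalar_uminus)
next
  case (add f g)
  show ?case
    by (rule ideal_eqI[OF ideal_add[OF add]]) (simp add: lie_der_add contr_add algebra_simps)
qed

lemma lie_der_ideal: "f \<in> rels \<Longrightarrow> lie_der x f \<in> rels"
proof (rule ideal_preserved[OF lie_der.additive_axioms])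
  fix z f assume "f \<in> rels" "lie_der x f \<in> rels"
  then show "lie_der x (gen z * f) \<in> rels" by (auto intro: ideal_add ideal_mult_left)
next
  fix y z f
  show "lie_der x (gen (y + z) * f) - lie_der x (gen y * f) - lie_der x (gen z * f) \<in> rels"
    by (rule ideal_eqI[OF ideal_add[OF gen_add_mem[of "br x y" "br x z" f]
            gen_add_mem[of y z "lie_der x f"]]])
      (simp add: br.add algebra_simps)
next
  fix b y f
  show "lie_der x (gen (gscale b y) * f) - lie_der x (gen y * (scalar b * f)) \<in> rels"
    by (rule ideal_eqI[OF ideal_add[OF ideal_add[OF
              gen_add_mem[of "gscale b (br x y)" "gscale (anchor x b) y" f]
              gen_gscale_mem[of gscale b "br x y" f]]
              ideal_add[OF gen_gscale_mem[of gscale "anchor x b" y f]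
              gen_gscale_mem[of gscale b y "lie_der x f"]]]])
      (simp add: br_gscale algebra_simps scalar_gen_simps)
next
  fix y f
  show "lie_der x (gen y * (gen y * f)) \<in> rels"
    by (rule ideal_eqI[OF ideal_add[OF gen_anticommute_mem[of "br x y" y f]
            gen_gen_mem[of y "lie_der x f"]]])
      (simp add: algebra_simps)
qed

lemma contr_ideal: "f \<in> rels \<Longrightarrow> contr a f \<in> rels"
proof (rule ideal_preserved[OF contr.additive_axioms])
  fix z f assume "f \<in> rels" "contr a f \<in> rels"
  then show "contr a (gen z * f) \<in> rels"
    by (auto intro: ideal_diff ideal_uminus ideal_mult_left)
next
  fix y z f
  show "contr a (gen (y + z) * f) - contr a (gen y * f) - contr a (gen z * f) \<in> rels"
    by (rule ideal_eqI[OF ideal_uminus[OF gen_add_mem[of y z "contr a f"]]])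
      (simp add: anchor_add scalar_add algebra_simps)
next
  fix b y f
  show "contr a (gen (gscale b y) * f) - contr a (gen y * (scalar b * f)) \<in> rels"
    by (rule ideal_eqI[OF ideal_uminus[OF gen_gscale_mem[of gscale b y "contr a f"]]])
      (simp add: anchor_gscale scalar_mult algebra_simps scalar_gen_simps)
next
  fix y f
  show "contr a (gen y * (gen y * f)) \<in> rels"
    by (rule ideal_eqI[OF gen_gen_mem[of y "contr a f"]])
      (simp add: algebra_simps scalar_gen_simps)
qed

text \<open>The first clause brackets the coefficient with \<open>g\<close>; it makes the result
  obey a Leibniz rule in the coefficient. The factor \<open>grade_inv\<close> supplies the sign
  (-1)^(length w).\<close>

primrec free_br_word :: "('g list \<Rightarrow>\<^sub>0 'a) \<Rightarrow> 'g list \<Rightarrow> 'a \<Rightarrow> 'g list \<Rightarrow>\<^sub>0 'a" where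
  "free_br_word g [] a = contr a g"
| "free_br_word g (x # w) a =
     gen x * free_br_word g w a + grade_inv (Poly_Mapping.single w a) * lie_der x g"

definition free_br :: "('g list \<Rightarrow>\<^sub>0 'a) \<Rightarrow> ('g list \<Rightarrow>\<^sub>0 'a) \<Rightarrow> ('g list \<Rightarrow>\<^sub>0 'a)" where
  "free_br f g = lin_ext (free_br_word g) f"

lemma free_br_word_add: "free_br_word g w (a + b) = free_br_word g w a + free_br_word g w b"
  by (induction w) (simp_all add: single_add grade_inv_add contr_add_scalar algebra_simps)

lemma free_br_add_left: "free_br (f + h) g = free_br f g + free_br h g"
  unfolding free_br_def by (rule lin_ext_add) (rule free_br_word_add)

lemma free_br_single: "free_br (Poly_Mapping.single w a) g = free_br_word g w a"
  unfolding free_br_def by (rule lin_ext_single) (rule free_br_word_add)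

lemma free_br_scalar [simp]: "free_br (scalar a) g = contr a g"
  using free_br_single[of "[]" a g] by (simp add: single_Nil)

lemma free_br_gen_mult [simp]: "free_br (gen x * f) g = gen x * free_br f g + grade_inv f * lie_der x g"
proof (induction f rule: single_induct)
  case (single w b)
  show ?case by (simp add: free_br_single single_Cons[symmetric])
qed (simp add: free_br_add_left grade_inv_add algebra_simps)

lemma free_br_add_right: "free_br f (g + h) = free_br f g + free_br f h"
  by (induction f rule: free_induct) (simp_all add: free_br_add_left lie_der_add contr_add algebra_simps)

interpretation free_br_left: additive "\<lambda>f. free_br f g" for g
  by standard (rule free_br_add_left)

interpretation free_br_right: additive "free_br f" for f
  by standard (rule free_br_add_right)

lemma free_br_ideal_right: "g \<in> rels \<Longrightarrow> free_br f g \<in> rels"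
  by (induction f rule: free_induct)
    (auto simp: free_br_add_left intro: contr_ideal lie_der_ideal ideal_add ideal_mult_left)

lemma free_br_scalar_mult_left: "free_br (scalar b * f) g = scalar b * free_br f g + f * contr b g"
proof (induction f rule: free_induct)
  case (scalar a)
  show ?case by (simp add: scalar_mult[symmetric]) (simp add: contr_mult)
next
  case (gen x f)
  have "free_br (scalar b * (gen x * f)) g = free_br (gen x * (scalar b * f)) g"
    by (simp only: scalar_left_commute)
  also have "\<dots> = scalar b * free_br (gen x * f) g + gen x * f * contr b g"
    by (simp only: free_br_gen_mult gen) (simp add: algebra_simps scalar_gen_simps)
  finally show ?case .
qed (simp add: free_br_add_left algebra_simps)

text \<open>The delicate relation is the scaling one. Letting \<open>b\<close> differentiate inside
  the Lie derivative gives \<open>grade_inv f * gen y * contr b g\<close>, letting it act as part of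
  the coefficient gives \<open>gen y * f * contr b g\<close>, and the two agree by moving
  \<open>y\<close> past \<open>f\<close>. For the alternating relation the two Lie derivative terms
  cancel exactly.\<close>

lemma free_br_ideal_left: "f \<in> rels \<Longrightarrow> free_br f g \<in> rels"
proof (rule ideal_preserved[OF free_br_left.additive_axioms])
  fix z f assume "f \<in> rels" "free_br f g \<in> rels"
  then show "free_br (gen z * f) g \<in> rels"
    by (auto intro: ideal_add ideal_mult_left ideal_mult_right grade_inv_ideal)
next
  fix y z f
  show "free_br (gen (y + z) * f) g - free_br (gen y * f) g - free_br (gen z * f) g \<in> rels"
    by (rule ideal_eqI[OF ideal_add[OF gen_add_mem[of y z "free_br f g"]
          ideal_mult_left[OF lie_der_add_gen_mem[of y z g], of "grade_inv f"]]])
      (simp add: algebra_simps)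
next
  fix b y f
  show "free_br (gen (gscale b y) * f) g - free_br (gen y * (scalar b * f)) g \<in> rels"
    by (rule ideal_eqI[OF ideal_diff[OF ideal_add[OF gen_gscale_mem[of gscale b y "free_br f g"]
          ideal_mult_left[OF lie_der_gscale_mem[of b y g], of "grade_inv f"]]
          ideal_mult_right[OF gen_commute_mem[of y f], of "contr b g"]]])
      (simp add: free_br_scalar_mult_left algebra_simps scalar_gen_simps scalar_left_commute[of "grade_inv f"])
next
  fix y f
  show "free_br (gen y * (gen y * f)) g \<in> rels"
    by (rule ideal_eqI[OF gen_gen_mem[of y "free_br f g"]]) (simp add: algebra_simps)
qed

section \<open>Leibniz rule, antisymmetry and Jacobi identity modulo the relations\<close>

lemma lie_der_of_gen [simp]: "lie_der x (gen y) = gen (br x y)"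
  using lie_der_gen[of x y "scalar 1"] anchor_mult[of x 1 1] by simp

lemma contr_of_gen [simp]: "contr a (gen y) = - scalar (anchor y a)"
  using contr_gen[of a y "scalar 1"] by simp

lemma free_br_gen [simp]: "free_br (gen x) g = lie_der x g"
proof -
  \<comment> \<open>A bare letter carries the coefficient 1, and its contribution to the recursion
    vanishes since derivations kill 1.\<close>
  have "contr 1 g = 0" using anchor_mult[of _ 1 1] by (intro contr_const) simp
  then show ?thesis using free_br_gen_mult[of x "scalar 1" g] by simp
qed

lemma grade_inv_lie_der: "grade_inv (lie_der x f) = lie_der x (grade_inv f)"
  by (induction f rule: free_induct)
    (simp_all add: grade_inv_add lie_der_add lie_der.minus)

lemma grade_inv_contr: "grade_inv (contr a f) = - contr a (grade_inv f)"
  by (induction f rule: free_induct)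
    (simp_all add: grade_inv_add grade_inv.zero grade_inv.minus grade_inv.diff contr_add contr.minus)

text \<open>The bracket has odd degree -1, which accounts for the sign.\<close>

lemma grade_inv_fbr: "grade_inv (free_br f g) = - free_br (grade_inv f) (grade_inv g)"
  by (induction f rule: free_induct)
    (simp_all add: grade_inv_add grade_inv_contr grade_inv_mult grade_inv_lie_der free_br_add_left
      free_br_left.minus)

lemma homog_free_br: "homog p f \<Longrightarrow> homog q g \<Longrightarrow> homog (p + q + 1) (free_br f g)"
  by (auto simp: homog_def grade_inv_fbr sgn_pow_def free_br_left.minus free_br_right.minus)

text \<open>Leibniz rule for a single letter on the right. For \<open>f\<close> of degree p the sign
  of passing \<open>y\<close> is (-1)^(p - 1), here written as minus the grade involution of
  \<open>f\<close>.\<close>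

lemma free_br_gen_right_mem:
  "free_br f (gen y * h) - free_br f (gen y) * h + gen y * free_br (grade_inv f) h \<in> rels"
proof (induction f rule: free_induct)
  case (scalar a)
  show ?case by (simp add: ext_ideal.zero)
next
  case (gen x f)
  show ?case
    by (rule ideal_eqI[OF ideal_diff[OF ideal_diff[OF ideal_mult_left[OF gen, of "gen x"]
              gen_anticommute_mem[of x y "free_br (grade_inv f) h"]]
            ideal_mult_right[OF gen_commute_mem[of y f], of "lie_der x h"]]])
      (simp add: free_br_left.minus algebra_simps)
next
  case (add f g)
  show ?case
    by (rule ideal_eqI[OF ideal_add[OF add]])
      (simp add: free_br_add_left grade_inv_add algebra_simps)
qed

lemma free_br_scalar_mult_right:
  "free_br f (scalar b * h) = free_br f (scalar b) * h + scalar b * free_br f h"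
  by (induction f rule: free_induct)
    (simp_all add: free_br_add_left algebra_simps scalar_gen_simps scalar_left_commute[of "grade_inv _"])

lemma free_br_mult_right_mem:
  assumes f: "homog p f"
  shows "free_br f (g * h) - free_br f g * h - twist (Suc p) g * free_br f h \<in> rels"
proof (induction g rule: free_induct)
  case (scalar b)
  show ?case by (simp add: free_br_scalar_mult_right twist_def ext_ideal.zero)
next
  case (gen y g)
  show ?case
    by (rule ideal_eqI[OF ideal_diff[OF ideal_diff[OF
              free_br_gen_right_mem[of f y "g * h"]
              ideal_mult_right[OF free_br_gen_right_mem[of f y g], of h]]
            ideal_sgn_pow[OF ideal_mult_left[OF gen, of "gen y"], of p]]])
      (use f in \<open>cases "even p"; simp add: homog_def twist_def sgn_pow_def free_br_left.minus algebra_simps\<close>)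
next
  case (add g k)
  show ?case
    by (rule ideal_eqI[OF ideal_add[OF add]])
      (simp add: twist_def free_br_add_right grade_inv_add algebra_simps)
qed

lemma contr_eq_fbr: "contr a g = free_br (grade_inv g) (scalar a)"
  by (induction g rule: free_induct)
    (simp_all add: contr_add free_br_add_left grade_inv_add free_br_left.minus scalar_central)

lemma lie_der_add_fbr_mem: "lie_der x g + free_br g (gen x) \<in> rels"
proof (induction g rule: free_induct)
  case (scalar b)
  show ?case by (simp add: ext_ideal.zero)
next
  case (gen y g)
  show ?case
    by (rule ideal_eqI[OF ideal_add[OF ideal_add[OF ideal_mult_left[OF gen, of "gen y"]
              gen_commute_mem[of "br x y" g]]
            ideal_mult_left[OF gen_uminus_mem[of "br x y" "scalar 1"], of "grade_inv g"]]])
      (simp add: br_anticommute[of x y] algebra_simps)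
next
  case (add f g)
  show ?case
    by (rule ideal_eqI[OF ideal_add[OF add]])
      (simp add: free_br_add_left lie_der_add algebra_simps)
qed

text \<open>For \<open>f\<close> of degree p the expected sign -(-1)^((p - 1)(q - 1)) factors as
  (-1)^q times (-1)^((q + 1) p). The second factor becomes \<open>twist (Suc q)\<close> on
  \<open>f\<close>, which lets the induction run over arbitrary \<open>f\<close>.\<close>

lemma free_br_swap_mem:
  assumes g: "homog q g"
  shows "free_br f g - sgn_pow q (free_br g (twist (Suc q) f)) \<in> rels"
proof (induction f rule: free_induct)
  case (scalar a)
  show ?case
    using g contr_eq_fbr[of a g]
    by (simp add: twist_def sgn_pow_def homog_def free_br_left.minus ext_ideal.zero split: if_splits)
next
  case (gen x f)
  have "homog q (free_br g (gen x))"
    using homog_free_br[OF g homog_gen[of x]] by (simp add: homog_def sgn_pow_def)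
  note c = commute_homog_mem[OF this, of "grade_inv f" gscale]
  show ?case
    by (rule ideal_eqI[OF ideal_add[OF ideal_diff[OF ideal_add[OF ideal_mult_left[OF gen, of "gen x"]
                ideal_mult_left[OF lie_der_add_fbr_mem[of x g], of "grade_inv f"]] c]
            free_br_gen_right_mem[of g x "twist (Suc q) f"]]])
      (use g in \<open>cases "even q"; simp add: homog_def twist_def sgn_pow_def free_br_left.minus
          free_br_right.minus algebra_simps\<close>)
next
  case (add f h)
  show ?case
    by (rule ideal_eqI[OF ideal_add[OF add]])
      (simp add: free_br_add_left free_br_add_right twist_def grade_inv_add sgn_pow_def algebra_simps)
qed

lemma free_br_antisym_mem:
  assumes "homog p f" "homog q g"
  shows "free_br f g + sgn_pow ((p + 1) * (q + 1)) (free_br g f) \<in> rels"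
  by (rule ideal_eqI[OF free_br_swap_mem[OF assms(2), of f]])
    (use homog_twist[OF assms(1), of "Suc q"] in \<open>cases "even p"; cases "even q";
      simp add: sgn_pow_def free_br_right.minus\<close>)

text \<open>The Leibniz rule applied twice. On forming the graded commutator in
  \<open>jacobiator_gen_mult_mem\<close>, the two mixed products, in which \<open>P\<close> and
  \<open>Q\<close> hit different factors, cancel; this is the usual reason why a commutator of
  derivations is a derivation.\<close>

lemma free_br_fbr_gen_mem:
  assumes P: "homog p P" and Q: "homog q Q"
  shows "free_br P (free_br Q (gen y * R)) - free_br P (free_br Q (gen y)) * R
    - sgn_pow ((p + 1) * q) (free_br Q (gen y) * free_br P R) + sgn_pow q (free_br P (gen y) * free_br Q R)
    - sgn_pow (p + q) (gen y * free_br P (free_br Q R)) \<in> rels"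
proof -
  have "homog q (free_br Q (gen y))"
    using homog_free_br[OF Q homog_gen[of y]] by (simp add: homog_def sgn_pow_def)
  note t = homog_twist[OF this, of "Suc p"]
  show ?thesis
    by (rule ideal_eqI[OF ideal_diff[OF ideal_add[OF
              free_br_ideal_right[OF free_br_gen_right_mem[of Q y R], of P]
              free_br_mult_right_mem[OF P, of "free_br Q (gen y)" R]]
            ideal_sgn_pow[OF free_br_gen_right_mem[of P y "free_br Q R"], of q]]])
      (use P Q t in \<open>cases "even p"; cases "even q"; simp add: homog_def sgn_pow_def free_br_left.minus
          free_br_right.minus free_br_right.add free_br_right.diff algebra_simps\<close>)
qed

text \<open>The degrees \<open>p - 1\<close> and \<open>q - 1\<close> appear as \<open>p + 1\<close> and \<open>q + 1\<close> to avoid truncated subtraction.\<close>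

definition jacobiator :: "nat \<Rightarrow> nat \<Rightarrow> ('g list \<Rightarrow>\<^sub>0 'a) \<Rightarrow> ('g list \<Rightarrow>\<^sub>0 'a) \<Rightarrow>
    ('g list \<Rightarrow>\<^sub>0 'a) \<Rightarrow> ('g list \<Rightarrow>\<^sub>0 'a)" where
  "jacobiator p q P Q R =
     free_br P (free_br Q R) - sgn_pow ((p + 1) * (q + 1)) (free_br Q (free_br P R)) - free_br (free_br P Q) R"

lemma jacobiator_gen_mult_mem:
  assumes P: "homog p P" and Q: "homog q Q"
    and y: "jacobiator p q P Q (gen y) \<in> rels" and R: "jacobiator p q P Q R \<in> rels"
  shows "jacobiator p q P Q (gen y * R) \<in> rels"
  by (rule ideal_eqI[OF ideal_add[OF ideal_diff[OF ideal_diff[OF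
            free_br_fbr_gen_mem[OF P Q, of y R]
            ideal_sgn_pow[OF free_br_fbr_gen_mem[OF Q P, of y R], of "(p + 1) * (q + 1)"]]
            free_br_gen_right_mem[of "free_br P Q" y R]]
          ideal_add[OF ideal_mult_right[OF y, of R]
            ideal_sgn_pow[OF ideal_mult_left[OF R, of "gen y"], of "p + q"]]]])
    (use homog_free_br[OF P Q] in \<open>cases "even p"; cases "even q"; simp add: jacobiator_def homog_def
        sgn_pow_def free_br_left.minus algebra_simps\<close>)

lemma jacobiator_add: "jacobiator p q P Q (f + g) = jacobiator p q P Q f + jacobiator p q P Q g"
  by (simp add: jacobiator_def free_br_add_right sgn_pow_def del: add_Suc_right mult_Suc even_mult_iff)

lemma jacobiator_induct_mem:
  assumes "homog p P" "homog q Q"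
    and "\<And>a. jacobiator p q P Q (scalar a) \<in> rels" "\<And>y. jacobiator p q P Q (gen y) \<in> rels"
  shows "jacobiator p q P Q R \<in> rels"
  by (induction R rule: free_induct)
    (simp_all add: assms jacobiator_gen_mult_mem jacobiator_add ideal_add)

lemma jacobiator_swap_left_mem:
  assumes "homog p P" "homog q Q" and "jacobiator p q P Q R \<in> rels"
  shows "jacobiator q p Q P R \<in> rels"
  by (rule ideal_eqI[OF ideal_uminus[OF ideal_add[OF
            ideal_sgn_pow[OF assms(3), of "(p + 1) * (q + 1)"]
            free_br_ideal_left[OF free_br_antisym_mem[OF assms(2,1)], of R]]]])
    (cases "even p"; cases "even q"; simp add: jacobiator_def sgn_pow_def free_br_left.minus
      free_br_left.add free_br_left.diff algebra_simps)

text \<open>Antisymmetry is used three times: inside \<open>[P, [R, Q]]\<close>, for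
  \<open>R\<close> against \<open>[P, Q]\<close>, and for \<open>[P, R]\<close> against
  \<open>Q\<close>.\<close>

lemma jacobiator_swap_right_mem:
  assumes P: "homog p P" and Q: "homog q Q" and R: "homog r R"
    and J: "jacobiator p q P Q R \<in> rels"
  shows "jacobiator p r P R Q \<in> rels"
  by (rule ideal_eqI[OF ideal_diff[OF ideal_diff[OF ideal_diff[OF
            free_br_ideal_right[OF free_br_antisym_mem[OF R Q], of P]
            ideal_sgn_pow[OF free_br_antisym_mem[OF R homog_free_br[OF P Q]], of "(p + 1) * (r + 1)"]]
            free_br_antisym_mem[OF homog_free_br[OF P R] Q]]
          ideal_sgn_pow[OF J, of "(q + 1) * (r + 1)"]]])
    (cases "even p"; cases "even q"; cases "even r"; simp add: jacobiator_def sgn_pow_def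
      free_br_right.minus free_br_right.add free_br_right.diff algebra_simps)

text \<open>Only three vectors require the relations, since there the Jacobi identity of G splits
  one letter into a sum. Two vectors and a scalar reduce to the anchor being a Lie morphism; with
  two or more scalars every term vanishes, as its degree would be negative.\<close>

lemma jacobiator_gens_mem:
  assumes "P = scalar a \<and> p = 0 \<or> P = gen x \<and> p = 1"
    and "Q = scalar b \<and> q = 0 \<or> Q = gen y \<and> q = 1"
    and "R = scalar c \<or> R = gen z"
  shows "jacobiator p q P Q R \<in> rels"
proof (cases "P = gen x \<and> p = 1 \<and> Q = gen y \<and> q = 1 \<and> R = gen z")
  case True
  have "br x (br y z) = br (br x y) z + br y (br x z)"
    using lie.br_jacobi[of x y z]
    by (simp add: br_anticommute[of x z] br_anticommute[of "br x y" z] br.minus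
        add_eq_0_iff2 algebra_simps)
  then show ?thesis
    using True gen_add_mem[of "br (br x y) z" "br y (br x z)" "scalar 1" gscale]
    by (simp add: jacobiator_def sgn_pow_def algebra_simps)
next
  case False
  then have "jacobiator p q P Q R = 0"
    using assms
    by (auto simp: jacobiator_def sgn_pow_def anchor_br scalar_diff scalar_uminus
        contr.zero contr.minus lie_der.zero lie_der.minus free_br_left.zero free_br_left.minus)
  then show ?thesis by (simp add: ext_ideal.zero)
qed

text \<open>\<open>jacobiator_induct_mem\<close> frees only the third slot from being a generator,
  so the swaps bring each argument there in turn. In \<open>1\<close> the third argument is
  arbitrary and in \<open>2\<close> also the second. Applying \<open>2\<close> to (R, P, Q) and
  swapping twice gives \<open>3\<close>, where only \<open>R\<close> is a generator, and a last
  induction removes that restriction.\<close>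

lemma jacobiator_mem:
  assumes P: "homog p P" and Q: "homog q Q"
  shows "jacobiator p q P Q R \<in> rels"
proof -
  define gens :: "(nat \<times> ('g list \<Rightarrow>\<^sub>0 'a)) set" where
    "gens = {(n, f). (\<exists>a. f = scalar a \<and> n = 0) \<or> (\<exists>x. f = gen x \<and> n = (1::nat))}"
  have gens_homog: "homog n f" if "(n, f) \<in> gens" for n f
    using that by (auto simp: gens_def homog_scalar intro: homog_gen[simplified])
  have gens_mem: "(0, scalar a) \<in> gens" "(1, gen x) \<in> gens" for a x
    by (auto simp: gens_def)
  have 1: "jacobiator p q P Q R \<in> rels" if "(p, P) \<in> gens" "(q, Q) \<in> gens" for p q P Q R
  proof (rule jacobiator_induct_mem)
    show "jacobiator p q P Q (scalar a) \<in> rels" "jacobiator p q P Q (gen x) \<in> rels" for a x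
      using that by (auto simp: gens_def intro!: jacobiator_gens_mem)
  qed (use that in \<open>auto intro: gens_homog\<close>)
  have 2: "jacobiator p q P Q R \<in> rels" if "(p, P) \<in> gens" "homog q Q" for p q P Q R
  proof (rule jacobiator_induct_mem)
    note swap = jacobiator_swap_right_mem[OF gens_homog[OF that(1)] gens_homog that(2) 1[OF that(1)]]
    show "jacobiator p q P Q (scalar a) \<in> rels" "jacobiator p q P Q (gen x) \<in> rels" for a x
      by (rule swap[OF gens_mem(1) gens_mem(1)] swap[OF gens_mem(2) gens_mem(2)])+
  qed (use that in \<open>auto intro: gens_homog\<close>)
  have 3: "jacobiator p q P Q R \<in> rels" if "(r, R) \<in> gens" for r R
    using jacobiator_swap_left_mem[OF gens_homog[OF that] P 2[OF that P]]
    by (rule jacobiator_swap_right_mem[OF P gens_homog[OF that] Q])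
  show ?thesis
    by (rule jacobiator_induct_mem[OF P Q]) (rule 3[OF gens_mem(1)] 3[OF gens_mem(2)])+
qed

section \<open>The bracket on the exterior algebra\<close>

lemma kscale_sgn: "kscale ((- 1) ^ n) a = sgn_pow n a"
  by (simp add: sgn_pow_def alg.scale_minus_left)

lemma single_kscale_sgn: "Poly_Mapping.single w (kscale ((- 1) ^ n) a) = sgn_pow n (Poly_Mapping.single w a)"
  by (simp add: kscale_sgn) (simp add: sgn_pow_def single_uminus)

text \<open>The exponent counts the letters to the right of the i-th one, over which
  \<open>grade_inv\<close> is taken in the recursion.\<close>

lemma free_br_single_scalar:
  "free_br (Poly_Mapping.single xs 1) (scalar a) =
    (\<Sum>i = 1..length xs. sgn_pow (length xs - i)
      (Poly_Mapping.single (omit_nth xs i) (anchor (xs ! (i - 1)) a)))"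
proof (induction xs)
  case (Cons x xs)
  have "free_br (Poly_Mapping.single (x # xs) 1) (scalar a) =
      sgn_pow (length xs) (Poly_Mapping.single xs (anchor x a))
      + gen x * free_br (Poly_Mapping.single xs 1) (scalar a)"
    by (simp add: single_Cons grade_inv_single sgn_pow_ring_simps scalar_central scalar_mult_single)
  also have "gen x * free_br (Poly_Mapping.single xs 1) (scalar a) =
      (\<Sum>i = 1..length xs. sgn_pow (length (x # xs) - Suc i)
        (Poly_Mapping.single (omit_nth (x # xs) (Suc i)) (anchor ((x # xs) ! (Suc i - 1)) a)))"
    unfolding Cons.IH sum_distrib_left
    by (intro sum.cong)
      (simp_all add: omit_nth_Cons nth_Cons_shift single_Cons sgn_pow_ring_simps)
  finally show ?case by (simp add: sum_one_upto_Suc omit_nth_Cons del: sum.cl_ivl_Suc)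
qed (simp add: single_Nil)

lemma contr_single_one:
  "contr a (Poly_Mapping.single xs 1) =
    (\<Sum>i = 1..length xs. sgn_pow i
      (Poly_Mapping.single (omit_nth xs i) (anchor (xs ! (i - 1)) a)))"
proof (induction xs)
  case (Cons x xs)
  have "contr a (Poly_Mapping.single (x # xs) 1) =
      sgn_pow 1 (Poly_Mapping.single xs (anchor x a)) + - (gen x * contr a (Poly_Mapping.single xs 1))"
    by (simp add: single_Cons scalar_mult_single sgn_pow_def)
  also have "- (gen x * contr a (Poly_Mapping.single xs 1)) =
      (\<Sum>i = 1..length xs. sgn_pow (Suc i)
        (Poly_Mapping.single (omit_nth (x # xs) (Suc i)) (anchor ((x # xs) ! (Suc i - 1)) a)))"
    unfolding Cons.IH sum_distrib_left sum_negf[symmetric]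
    by (intro sum.cong) (simp_all add: omit_nth_Cons nth_Cons_shift single_Cons sgn_pow_def)
  finally show ?case by (simp add: sum_one_upto_Suc omit_nth_Cons del: sum.cl_ivl_Suc)
qed (simp add: single_Nil)

text \<open>A derivation leaves the new letter in position j, whereas the sum has it in front;
  crossing j - 1 letters produces the sign.\<close>

lemma lie_der_single_one_mem:
  "lie_der x (Poly_Mapping.single ys 1)
    - (\<Sum>j = 1..length ys. sgn_pow (Suc j)
        (gen (br x (ys ! (j - 1))) * Poly_Mapping.single (omit_nth ys j) 1)) \<in> rels"
proof (induction ys)
  case Nil
  show ?case using anchor_kscale_one[of x 1] by (simp add: single_Nil ext_ideal.zero)
next
  case (Cons y ys)
  let ?t = "\<lambda>j. gen (br x (ys ! (j - 1)))" and ?o = "\<lambda>j. Poly_Mapping.single (omit_nth ys j) 1"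
  have sum: "(\<Sum>j = 1..length (y # ys). sgn_pow (Suc j)
        (gen (br x ((y # ys) ! (j - 1))) * Poly_Mapping.single (omit_nth (y # ys) j) 1))
      = gen (br x y) * Poly_Mapping.single ys 1
        - (\<Sum>j = 1..length ys. sgn_pow (Suc j) (?t j * (gen y * ?o j)))"
    by (simp add: sum_one_upto_Suc omit_nth_Cons(1) sgn_pow_def flip: sum_negf del: sum.cl_ivl_Suc,
        intro sum.cong refl, simp add: omit_nth_Cons nth_Cons_shift single_Cons)
  have swap: "(\<Sum>j = 1..length ys. sgn_pow (Suc j) (gen y * (?t j * ?o j) + ?t j * (gen y * ?o j))) \<in> rels"
    by (intro ideal_sum ideal_sgn_pow gen_anticommute_mem)
  show ?case
    unfolding sum
    by (rule ideal_eqI[OF ideal_add[OF ideal_mult_left[OF Cons.IH, of "gen y"] swap]])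
      (simp add: single_Cons right_diff_distrib sum_distrib_left sum.distrib sgn_pow_ring_simps)
qed

lemma free_br_single_single_mem:
  "free_br (Poly_Mapping.single xs 1) (Poly_Mapping.single ys 1)
    - (\<Sum>i = 1..length xs. \<Sum>j = 1..length ys. sgn_pow (i + j)
        (gen (br (xs ! (i - 1)) (ys ! (j - 1))) *
          (Poly_Mapping.single (omit_nth xs i) 1 * Poly_Mapping.single (omit_nth ys j) 1))) \<in> rels"
proof (induction xs)
  case Nil
  have "contr 1 (Poly_Mapping.single ys 1) = 0"
    using anchor_kscale_one[of _ 1] by (intro contr_const) simp
  then show ?case by (simp add: single_Nil ext_ideal.zero)
next
  case (Cons x xs)
  let ?X = "Poly_Mapping.single xs (1 :: 'a)" and ?Y = "Poly_Mapping.single ys (1 :: 'a)"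
  let ?t = "\<lambda>i j. gen (br (xs ! (i - 1)) (ys ! (j - 1))) :: 'g list \<Rightarrow>\<^sub>0 'a"
    and ?u = "\<lambda>j. gen (br x (ys ! (j - 1))) :: 'g list \<Rightarrow>\<^sub>0 'a"
    and ?o = "\<lambda>i j. Poly_Mapping.single (omit_nth xs i) 1 * Poly_Mapping.single (omit_nth ys j) (1 :: 'a)"
    and ?p = "\<lambda>j. Poly_Mapping.single (omit_nth ys j) (1 :: 'a)"
  have tail: "(\<Sum>i = 1..length xs. \<Sum>j = 1..length ys. sgn_pow (Suc i + j)
        (gen (br ((x # xs) ! (Suc i - 1)) (ys ! (j - 1))) *
          (Poly_Mapping.single (omit_nth (x # xs) (Suc i)) 1 * ?p j)))
      = - (\<Sum>i = 1..length xs. \<Sum>j = 1..length ys. sgn_pow (i + j) (?t i j * (gen x * ?o i j)))"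
    unfolding sum_negf[symmetric]
    by (intro sum.cong refl)
      (simp add: omit_nth_Cons nth_Cons_shift single_Cons sgn_pow_def mult.assoc)
  have sum: "(\<Sum>i = 1..length (x # xs). \<Sum>j = 1..length ys. sgn_pow (i + j)
        (gen (br ((x # xs) ! (i - 1)) (ys ! (j - 1))) *
          (Poly_Mapping.single (omit_nth (x # xs) i) 1 * ?p j)))
      = (\<Sum>j = 1..length ys. sgn_pow (Suc j) (?u j * (?X * ?p j)))
        - (\<Sum>i = 1..length xs. \<Sum>j = 1..length ys. sgn_pow (i + j) (?t i j * (gen x * ?o i j)))"
    using tail by (simp add: sum_one_upto_Suc omit_nth_Cons(1) del: sum.cl_ivl_Suc)
  \<comment> \<open>Carries \<open>x\<close> across the bracket letter; this crossing is the change
    of sign from index i to \<open>Suc i\<close>.\<close>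
  have swap: "(\<Sum>i = 1..length xs. \<Sum>j = 1..length ys.
      sgn_pow (i + j) (gen x * (?t i j * ?o i j) + ?t i j * (gen x * ?o i j))) \<in> rels"
    by (intro ideal_sum ideal_sgn_pow gen_anticommute_mem)
  \<comment> \<open>In the term where \<open>x\<close> itself is bracketed, the new letter stands
    behind \<open>xs\<close>; bringing it to the front cancels the sign in
    \<open>grade_inv ?X\<close>.\<close>
  have move: "(\<Sum>j = 1..length ys. sgn_pow (Suc j) ((?u j * ?X - grade_inv ?X * ?u j) * ?p j)) \<in> rels"
    by (intro ideal_sum ideal_sgn_pow ideal_mult_right gen_commute_mem)
  have diff: "sgn_pow n (f - g) = sgn_pow n f - sgn_pow n g" for n and f g :: "'g list \<Rightarrow>\<^sub>0 'a"
    by (simp add: sgn_pow_def)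
  show ?case
    unfolding sum
    by (rule ideal_eqI[OF ideal_diff[OF ideal_add[OF ideal_add[OF ideal_mult_left[OF Cons.IH, of "gen x"] swap]
            ideal_mult_left[OF lie_der_single_one_mem[of x ys], of "grade_inv ?X"]] move]])
      (simp add: single_Cons right_diff_distrib left_diff_distrib sum_distrib_left sum.distrib
        sum_subtractf diff sgn_pow_ring_simps(1,3) mult.assoc)
qed

section \<open>Existence of the bracket on the quotient\<close>

lemma kscale_map: "Poly_Mapping.map (kscale c) f = scalar (kscale c 1) * f"
proof -
  have "kscale c = (*) (kscale c 1)"
  proof
    show "kscale c b = kscale c 1 * b" for b using alg.kscale_mult_left[of c 1 b] by simp
  qed
  then have "Poly_Mapping.map (kscale c) f = Poly_Mapping.map ((*) (kscale c 1)) f" by (rule arg_cong)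
  then show ?thesis by (simp only: mult_map_scale_conv_mult scalar_def zero_list_def)
qed

lemma ext_kscale_class:
  "ext_kscale kscale gscale c (ext_class gscale f) = ext_class gscale (scalar (kscale c 1) * f)"
  unfolding ext_kscale_def
  by (subst ext_class_UN)
    (auto simp: kscale_map ext_class_eq_iff simp flip: right_diff_distrib intro: ideal_mult_left)

definition quot_br ::
    "('g list \<Rightarrow>\<^sub>0 'a) set \<Rightarrow> ('g list \<Rightarrow>\<^sub>0 'a) set \<Rightarrow> ('g list \<Rightarrow>\<^sub>0 'a) set" where
  "quot_br X Y = (if X \<in> ext_algebra gscale \<and> Y \<in> ext_algebra gscale
     then \<Union>f\<in>X. \<Union>g\<in>Y. ext_class gscale (free_br f g) else undefined)"

lemma quot_br_class: "quot_br (ext_class gscale f) (ext_class gscale g) = ext_class gscale (free_br f g)"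
proof -
  have right: "(\<Union>g'\<in>ext_class gscale g. ext_class gscale (free_br h g')) = ext_class gscale (free_br h g)" for h
  proof (rule ext_class_UN)
    fix g' assume "g' - g \<in> rels"
    from free_br_ideal_right[OF this, of h] free_br_add_right[of h "g' - g" g]
    show "ext_class gscale (free_br h g') = ext_class gscale (free_br h g)"
      by (simp add: ext_class_eq_iff)
  qed
  have "(\<Union>f'\<in>ext_class gscale f. ext_class gscale (free_br f' g)) = ext_class gscale (free_br f g)"
  proof (rule ext_class_UN)
    fix f' assume "f' - f \<in> rels"
    from free_br_ideal_left[OF this, of g] free_br_add_left[of "f' - f" f g]
    show "ext_class gscale (free_br f' g) = ext_class gscale (free_br f g)"
      by (simp add: ext_class_eq_iff)
  qed
  then show ?thesis by (simp add: quot_br_def right ext_algebra_def)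
qed

lemma is_schouten_bracket_quot_br: "is_schouten_bracket kscale gscale br anchor quot_br"
proof -
  \<comment> \<open>Scaling by K is multiplication by a constant of A. The correction terms of the
    Leibniz rules are brackets with that constant, so they vanish and K-bilinearity follows.\<close>
  have const: "contr (kscale c 1) f = 0" for c f
    by (rule contr_const) (rule anchor_kscale_one)
  have const': "free_br f (scalar (kscale c 1)) = 0" for c f
    using contr_eq_fbr[of "kscale c 1" "grade_inv f"] by (simp add: const)
  show ?thesis
    unfolding is_schouten_bracket_def
  proof (intro conjI ballI allI impI)
    fix xs ys :: "'g list" assume "xs \<noteq> []" "ys \<noteq> []"
    show "quot_br (ext_wedge gscale xs) (ext_wedge gscale ys) =
        ext_class gscale (\<Sum>i = 1..length xs. \<Sum>j = 1..length ys.
          Poly_Mapping.single ([br (xs ! (i - 1)) (ys ! (j - 1))] @ omit_nth xs i @ omit_nth ys j)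
            (kscale ((-1) ^ (i + j)) 1))"
      using free_br_single_single_mem[of xs ys]
      by (simp add: ext_wedge_def quot_br_class ext_class_eq_iff single_kscale_sgn single_Cons
          single_append[of "omit_nth _ _"])
  next
    fix xs :: "'g list" and a assume "xs \<noteq> []"
    show "quot_br (ext_wedge gscale xs) (ext_scalar gscale a) =
        ext_class gscale (\<Sum>i = 1..length xs. Poly_Mapping.single (omit_nth xs i)
            (kscale ((-1) ^ (length xs - i)) (anchor (xs ! (i - 1)) a)))"
      by (simp add: ext_wedge_def ext_scalar_def quot_br_class single_kscale_sgn single_Nil
          free_br_single_scalar)
    show "quot_br (ext_scalar gscale a) (ext_wedge gscale xs) =
        ext_class gscale (\<Sum>i = 1..length xs. Poly_Mapping.single (omit_nth xs i)
            (kscale ((-1) ^ i) (anchor (xs ! (i - 1)) a)))"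
      by (simp add: ext_wedge_def ext_scalar_def quot_br_class single_kscale_sgn single_Nil
          contr_single_one)
  next
    fix a b :: 'a
    show "quot_br (ext_scalar gscale a) (ext_scalar gscale b) = ext_class gscale 0"
      by (simp add: ext_scalar_def quot_br_class single_Nil)
  next
    fix X Y assume "X \<in> ext_algebra gscale" "Y \<in> ext_algebra gscale"
    then obtain f g where fg: "X = ext_class gscale f" "Y = ext_class gscale g"
      by (auto simp: ext_algebra_def)
    show "quot_br X Y \<in> ext_algebra gscale"
      by (simp add: fg quot_br_class ext_algebra_def)
    show "quot_br (ext_kscale kscale gscale c X) Y = ext_kscale kscale gscale c (quot_br X Y)" for c
      by (simp add: fg ext_kscale_class quot_br_class free_br_scalar_mult_left const)
    show "quot_br X (ext_kscale kscale gscale c Y) = ext_kscale kscale gscale c (quot_br X Y)" for c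
      by (simp add: fg ext_kscale_class quot_br_class free_br_scalar_mult_right const')
    fix Z assume "Z \<in> ext_algebra gscale"
    then obtain h where h: "Z = ext_class gscale h" by (auto simp: ext_algebra_def)
    show "quot_br (ext_add gscale X Y) Z = ext_add gscale (quot_br X Z) (quot_br Y Z)"
      by (simp add: fg h ext_add_class quot_br_class free_br_add_left)
    show "quot_br Z (ext_add gscale X Y) = ext_add gscale (quot_br Z X) (quot_br Z Y)"
      by (simp add: fg h ext_add_class quot_br_class free_br_add_right)
  next
    fix X Y assume "X \<notin> ext_algebra gscale \<or> Y \<notin> ext_algebra gscale"
    then show "quot_br X Y = undefined" by (auto simp: quot_br_def)
  qed
qed

section \<open>Uniqueness of the bracket and the graded commutator\<close>

lemma is_schouten_bracket_unique:
  assumes B: "is_schouten_bracket kscale gscale br anchor B"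
    and C: "is_schouten_bracket kscale gscale br anchor C"
  shows "B = C"
proof (intro ext)
  fix X Y
  have alg: "ext_class gscale f \<in> ext_algebra gscale" for f :: "'g list \<Rightarrow>\<^sub>0 'a"
    by (simp add: ext_algebra_def)
  have add: "B (ext_class gscale (f + g)) (ext_class gscale h)
        = ext_add gscale (B (ext_class gscale f) (ext_class gscale h)) (B (ext_class gscale g) (ext_class gscale h))
      \<and> B (ext_class gscale h) (ext_class gscale (f + g))
        = ext_add gscale (B (ext_class gscale h) (ext_class gscale f)) (B (ext_class gscale h) (ext_class gscale g))"
    if "is_schouten_bracket kscale gscale br anchor B" for B and f g h :: "'g list \<Rightarrow>\<^sub>0 'a"
  proof -
    have "\<forall>X\<in>ext_algebra gscale. \<forall>Y\<in>ext_algebra gscale. \<forall>Z\<in>ext_algebra gscale.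
        B (ext_add gscale X Y) Z = ext_add gscale (B X Z) (B Y Z) \<and>
        B Z (ext_add gscale X Y) = ext_add gscale (B Z X) (B Z Y)"
      using that unfolding is_schouten_bracket_def by - (elim conjE, assumption)
    from bspec[OF bspec[OF bspec[OF this alg[of f]] alg[of g]] alg[of h]]
    show ?thesis by (simp only: ext_add_class)
  qed
  \<comment> \<open>The coefficient of a nonempty word is absorbed into its first letter, so the
    clauses for words with coefficient 1, together with additivity, determine the bracket.\<close>
  have word: "\<exists>ys. ys \<noteq> [] \<and> ext_class gscale (Poly_Mapping.single w a) = ext_wedge gscale ys"
    if "w \<noteq> []" for w and a :: 'a
  proof -
    obtain x v where w: "w = x # v" using \<open>w \<noteq> []\<close> by (cases w) auto
    have "Poly_Mapping.single (gscale a x # v) 1 - Poly_Mapping.single w a \<in> rels"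
      using ext_ideal.homogeneous[of "[]" gscale a x v 1] by (simp add: w)
    then show ?thesis
      by (intro exI[of _ "gscale a x # v"]) (metis ext_wedge_def ext_class_eq_iff list.distinct(1))
  qed
  have single: "B (ext_class gscale (Poly_Mapping.single w a)) (ext_class gscale (Poly_Mapping.single v b))
      = C (ext_class gscale (Poly_Mapping.single w a)) (ext_class gscale (Poly_Mapping.single v b))"
    for w v and a b :: 'a
  proof -
    consider (ss) "w = []" "v = []" | (sw) "w = []" "v \<noteq> []" | (ws) "w \<noteq> []" "v = []"
      | (ww) "w \<noteq> []" "v \<noteq> []" by blast
    then show ?thesis
    proof cases
      case ss
      then show ?thesis
        using B C by (simp add: is_schouten_bracket_def flip: ext_scalar_def)
    next
      case sw
      then show ?thesis
        using B C word[OF sw(2), of b] by (auto simp: is_schouten_bracket_def simp flip: ext_scalar_def)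
    next
      case ws
      then show ?thesis
        using B C word[OF ws(1), of a] by (auto simp: is_schouten_bracket_def simp flip: ext_scalar_def)
    next
      case ww
      then show ?thesis
        using B C word[OF ww(1), of a] word[OF ww(2), of b] by (auto simp: is_schouten_bracket_def)
    qed
  qed
  have left: "B (ext_class gscale (Poly_Mapping.single w a)) (ext_class gscale g)
      = C (ext_class gscale (Poly_Mapping.single w a)) (ext_class gscale g)" for w a g
    by (induction g rule: single_induct) (simp_all add: single add[OF B] add[OF C])
  have eq: "B (ext_class gscale f) (ext_class gscale g) = C (ext_class gscale f) (ext_class gscale g)" for f g
    by (induction f rule: single_induct) (simp_all add: left add[OF B] add[OF C])
  show "B X Y = C X Y"
  proof (cases "X \<in> ext_algebra gscale \<and> Y \<in> ext_algebra gscale")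
    case True
    then show ?thesis by (auto simp: ext_algebra_def eq)
  next
    case False
    then show ?thesis using B C unfolding is_schouten_bracket_def by metis
  qed
qed

lemma schouten_bracket_eq: "schouten_bracket kscale gscale br anchor = quot_br"
  unfolding schouten_bracket_def
  by (rule the_equality) (auto intro: is_schouten_bracket_quot_br is_schouten_bracket_unique)

lemma graded_commutator_ad:
  assumes P: "P \<in> ext_power gscale p" and Q: "Q \<in> ext_power gscale q"
    and R: "R \<in> ext_algebra gscale"
  shows "graded_commutator kscale gscale (p - 1) (q - 1)
      (ad_SN kscale gscale br anchor P) (ad_SN kscale gscale br anchor Q) R =
    ad_SN kscale gscale br anchor (schouten_bracket kscale gscale br anchor P Q) R"
proof -
  obtain f where f: "P = ext_class gscale f" "\<forall>w\<in>Poly_Mapping.keys f. int (length w) = p"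
    using P by (auto simp: ext_power_def)
  obtain g where g: "Q = ext_class gscale g" "\<forall>w\<in>Poly_Mapping.keys g. int (length w) = q"
    using Q by (auto simp: ext_power_def)
  obtain h where h: "R = ext_class gscale h" using R by (auto simp: ext_algebra_def)
  \<comment> \<open>Only parities enter the signs, so the integer degrees are replaced by natural
    residues mod 2. A negative degree is covered too: the representative then has no words at
    all.\<close>
  define m n where "m = nat (p mod 2)" and "n = nat (q mod 2)"
  have mn: "even m \<longleftrightarrow> even p" "even n \<longleftrightarrow> even q" by (auto simp: m_def n_def even_nat_iff)
  have "homog m f" "homog n g"
    using f(2) g(2) mn by (auto intro!: homog_length)
  from jacobiator_mem[OF this, of h]
  have "free_br f (free_br g h) - sgn_pow ((m + 1) * (n + 1)) (free_br g (free_br f h)) - free_br (free_br f g) h \<in> rels"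
    by (simp only: jacobiator_def)
  moreover have sign: "scalar (kscale ((-1) powi ((p - 1) * (q - 1))) 1) * k = sgn_pow ((m + 1) * (n + 1)) k"
    for k
    using mn by (cases "even p"; cases "even q")
      (simp_all add: power_int_minus_left sgn_pow_def alg.scale_minus_left scalar_uminus)
  ultimately show ?thesis
    by (simp only: graded_commutator_def ad_SN_def schouten_bracket_eq f(1) g(1) h quot_br_class
        ext_kscale_class ext_diff_class ext_class_eq_iff o_apply sign)
qed

end

theorem theorem5p2:
  fixes kscale :: "'k::field_char_0 \<Rightarrow> 'a::{comm_ring,comm_monoid_mult} \<Rightarrow> 'a"
    and gscale :: "'a \<Rightarrow> 'g::ab_group_add \<Rightarrow> 'g"
    and br :: "'g \<Rightarrow> 'g \<Rightarrow> 'g"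
    and anchor :: "'g \<Rightarrow> 'a \<Rightarrow> 'a"
    and p q :: int
    and P Q :: "('g list \<Rightarrow>\<^sub>0 'a) set"
  assumes "lie_rinehart kscale gscale br anchor"
    and "P \<in> ext_power gscale p"
    and "Q \<in> ext_power gscale q"
  shows "\<forall>R \<in> ext_algebra gscale.
    graded_commutator kscale gscale (p - 1) (q - 1)
      (ad_SN kscale gscale br anchor P) (ad_SN kscale gscale br anchor Q) R =
    ad_SN kscale gscale br anchor (schouten_bracket kscale gscale br anchor P Q) R"
  using lie_rinehart.graded_commutator_ad[OF assms] by blast

end
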